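(* Let $G$ be a group acting on a CAT(0) cube complex $X$ with trivial vertex-stabilisers. Assume that $\mathcal{J}$ is a $G$-invariant collection of hyperplanes such that $G$ contains a reflection $r_J$ along each hyperplane $J$ of $\mathcal{J}$. Fix a basepoint (a vertex) $x_0\in X$ and let $Y\subset X$ denote the intersection of all the halfspaces which are delimited by hyperplanes of $\mathcal{J}$ and which contain $x_0$. Then $$G=R\rtimes\mathrm{stab}(Y),\quad\text{where } R=\langle r_J,\ J\in\mathcal{J}\rangle .$$ Moreover, $Y$ is a fundamental domain of $R\curvearrowright X$ and, if $\mathcal{J}_0$ denotes the maximal $x_0$-peripheral subcollection of $\mathcal{J}$ (i.e. the collection of the hyperplanes $J\in\mathcal{J}$ such that no hyperplane of $\mathcal{J}$ separates $x_0$ from $J$) and if $\Delta$ denotes its crossing graph, then the map sending a vertex $J$ of $\Delta$ to the reflection $r_J$ of $R$ induces an isomorphism $C(\Delta)\to R$.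
   Context: A CAT(0) cube complex is identified with its one-skeleton (so $X$ is viewed as a graph, and $x\in X$ means a vertex); actions are by cubical automorphisms. A hyperplane is an equivalence class of edges for the equivalence relation generated by identifying opposite edges of squares; the edges in the class are dual to it. Removing the interiors of the edges dual to a hyperplane $J$ leaves two connected components, the halfspaces delimited by $J$. Two distinct hyperplanes are transverse if some square contains edges dual to each. $J$ separates $x_0$ from another hyperplane $K$ if $J\ne K$ are not transverse and $K$ lies in the halfspace delimited by $J$ not containing $x_0$. A collection of hyperplanes is $x_0$-peripheral if no hyperplane of it separates $x_0$ from another hyperplane of it. The crossing graph of a collection of hyperplanes has these hyperplanes as vertices and edges linking transverse hyperplanes. A reflection along $J$ is an isometry of $X$ which inverts each edge dual to $J$. $Y$ is a fundamental domain of $R\curvearrowright X$ if every $R$-orbit of vertices of $X$ meets $Y$ in exactly one vertex. $C(\Delta)=\langle u\in V(\Delta)\mid u^2=1\ (u\in V(\Delta)),\ [u,v]=1\text{ if }\{u,v\}\in E(\Delta)\rangle$. *)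

theory Defs
  imports "HOL-Algebra.Group_Action" "HOL-Algebra.Generated_Groups"
begin

section \<open>Cube complexes\<close>

text \<open>A cubical complex is given by the vertex sets of its cubes. The vertices of the \<open>n\<close>-cube are
  the subsets of \<open>{..<n}\<close> and its nonempty faces are the intervals \<open>{A..B} = {S. A \<subseteq> S \<and> S \<subseteq> B}\<close>.
  Cubes are embedded and two cubes meet, if at all, in a single common face; cube complexes with this
  property include all the CAT(0) ones, and there every cube is determined by its vertices.
  Every single cube is finite-dimensional, but the complex itself need not be, nor need it be
  locally finite.\<close>

definition cube_complex :: "'v set set \<Rightarrow> bool" where
  "cube_complex X \<longleftrightarrow>
     (\<forall>C\<in>X. \<exists>n. \<exists>\<kappa> :: nat set \<Rightarrow> 'v. bij_betw \<kappa> (Pow {..<n}) C \<and>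
        {D \<in> X. D \<subseteq> C} = {\<kappa> ` {A..B} |A B. A \<subseteq> B \<and> B \<subseteq> {..<n}}) \<and>
     (\<forall>C\<in>X. \<forall>D\<in>X. C \<inter> D \<noteq> {} \<longrightarrow> C \<inter> D \<in> X)"

definition vertices :: "'v set set \<Rightarrow> 'v set" where
  "vertices X = \<Union>X"

definition edges :: "'v set set \<Rightarrow> 'v set set" where
  "edges X = {e \<in> X. card e = 2}"

definition squares :: "'v set set \<Rightarrow> 'v set set" where
  "squares X = {Q \<in> X. card Q = 4}"

text \<open>The vertices of the link of \<open>v\<close> are the edges at \<open>v\<close>, represented by their other endpoints; each
  cube containing \<open>v\<close> gives the simplex of those of its edges that contain \<open>v\<close>. Since two cubes meet in
  a common face, distinct cubes at \<open>v\<close> give distinct simplices, so that links are automatically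
  simplicial complexes and only flagness has to be required. The cube \<open>{v}\<close> gives the empty simplex.\<close>

definition link :: "'v set set \<Rightarrow> 'v \<Rightarrow> 'v set set" where
  "link X v = {{a \<in> C. {v, a} \<in> edges X} |C. C \<in> X \<and> v \<in> C}"

definition flag :: "'v set set \<Rightarrow> bool" where
  "flag L \<longleftrightarrow> (\<forall>S. finite S \<and> (\<forall>a\<in>S. {a} \<in> L) \<and> (\<forall>a\<in>S. \<forall>b\<in>S. a \<noteq> b \<longrightarrow> {a, b} \<in> L) \<longrightarrow> S \<in> L)"

definition edge_path :: "'v set set \<Rightarrow> 'v list \<Rightarrow> bool" where
  "edge_path X p \<longleftrightarrow> p \<noteq> [] \<and> set p \<subseteq> vertices X \<and> successively (\<lambda>a b. {a, b} \<in> edges X) p"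

text \<open>Homotopy with fixed endpoints of edge paths, generated by removing backtracks and pushing the
  path across squares. It computes the fundamental group, as this only depends on the 2-skeleton.\<close>

inductive edge_homotopic :: "'v set set \<Rightarrow> 'v list \<Rightarrow> 'v list \<Rightarrow> bool" for X where
  refl: "edge_homotopic X p p"
| sym: "edge_homotopic X p q \<Longrightarrow> edge_homotopic X q p"
| trans: "edge_homotopic X p q \<Longrightarrow> edge_homotopic X q s \<Longrightarrow> edge_homotopic X p s"
| backtrack: "{a, b} \<in> edges X \<Longrightarrow> edge_homotopic X (p @ [a, b, a] @ q) (p @ [a] @ q)"
| square: "\<lbrakk>{a, b, c, d} \<in> squares X; {a, b} \<in> edges X; {b, c} \<in> edges X; {a, d} \<in> edges X;
     {d, c} \<in> edges X\<rbrakk> \<Longrightarrow> edge_homotopic X (p @ [a, b, c] @ q) (p @ [a, d, c] @ q)"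

definition edge_connected :: "'v set set \<Rightarrow> bool" where
  "edge_connected X \<longleftrightarrow>
     (\<forall>x\<in>vertices X. \<forall>y\<in>vertices X. \<exists>p. edge_path X p \<and> hd p = x \<and> last p = y)"

definition edge_simply_connected :: "'v set set \<Rightarrow> bool" where
  "edge_simply_connected X \<longleftrightarrow> edge_connected X \<and>
     (\<forall>p. edge_path X p \<and> hd p = last p \<longrightarrow> edge_homotopic X p [hd p])"

definition CAT0_cube_complex :: "'v set set \<Rightarrow> bool" where
  "CAT0_cube_complex X \<longleftrightarrow>
     cube_complex X \<and> (\<forall>v\<in>vertices X. flag (link X v)) \<and> edge_simply_connected X"

definition cubical_automorphism :: "'v set set \<Rightarrow> ('v \<Rightarrow> 'v) \<Rightarrow> bool" where
  "cubical_automorphism X f \<longleftrightarrow> bij_betw f (vertices X) (vertices X) \<and> image f ` X = X"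

definition edge_dist :: "'v set set \<Rightarrow> 'v \<Rightarrow> 'v \<Rightarrow> nat" where
  "edge_dist X x y = (LEAST n. (x, y) \<in> {(a, b). {a, b} \<in> edges X} ^^ n)"

section \<open>Hyperplanes\<close>

text \<open>Two edges of a square are opposite iff they are disjoint. A hyperplane is represented by its set
  of dual edges.\<close>

definition opposite :: "'v set set \<Rightarrow> ('v set \<times> 'v set) set" where
  "opposite X = {(e, f). e \<in> edges X \<and> f \<in> edges X \<and> e \<inter> f = {} \<and>
     (\<exists>Q\<in>squares X. e \<subseteq> Q \<and> f \<subseteq> Q)}"

definition parallel :: "'v set set \<Rightarrow> ('v set \<times> 'v set) set" where
  "parallel X = (opposite X)\<^sup>* \<inter> edges X \<times> edges X"

definition hyperplanes :: "'v set set \<Rightarrow> 'v set set set" where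
  "hyperplanes X = edges X // parallel X"

text \<open>The vertex sets of the connected components of the graph with the edges in \<open>J\<close> removed.\<close>

definition halfspaces :: "'v set set \<Rightarrow> 'v set set \<Rightarrow> 'v set set" where
  "halfspaces X J =
     vertices X // ({(a, b). {a, b} \<in> edges X - J}\<^sup>* \<inter> vertices X \<times> vertices X)"

definition transverse :: "'v set set \<Rightarrow> 'v set set \<Rightarrow> 'v set set \<Rightarrow> bool" where
  "transverse X J K \<longleftrightarrow> J \<noteq> K \<and> (\<exists>Q\<in>squares X. \<exists>e\<in>J. \<exists>f\<in>K. e \<subseteq> Q \<and> f \<subseteq> Q)"

text \<open>\<open>separates X x J K\<close>: \<open>J\<close> separates \<open>x\<close> from \<open>K\<close>. Here \<open>\<Union>K\<close> is the set of endpoints of the edges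
  dual to \<open>K\<close>.\<close>

definition separates :: "'v set set \<Rightarrow> 'v \<Rightarrow> 'v set set \<Rightarrow> 'v set set \<Rightarrow> bool" where
  "separates X x J K \<longleftrightarrow> J \<noteq> K \<and> \<not> transverse X J K \<and> (\<exists>H\<in>halfspaces X J. x \<notin> H \<and> \<Union>K \<subseteq> H)"

definition maximal_peripheral :: "'v set set \<Rightarrow> 'v \<Rightarrow> 'v set set set \<Rightarrow> 'v set set set" where
  "maximal_peripheral X x \<J> = {J \<in> \<J>. \<not> (\<exists>K\<in>\<J>. separates X x K J)}"

definition halfspace_intersection :: "'v set set \<Rightarrow> 'v set set set \<Rightarrow> 'v \<Rightarrow> 'v set" where
  "halfspace_intersection X \<J> x =
     {y \<in> vertices X. \<forall>J\<in>\<J>. \<forall>H\<in>halfspaces X J. x \<in> H \<longrightarrow> y \<in> H}"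

text \<open>As \<open>{a, b} = {b, a}\<close>, the last conjunct says that \<open>f\<close> swaps the endpoints of each edge in \<open>J\<close>.\<close>

definition reflection :: "'v set set \<Rightarrow> 'v set set \<Rightarrow> ('v \<Rightarrow> 'v) \<Rightarrow> bool" where
  "reflection X J f \<longleftrightarrow> bij_betw f (vertices X) (vertices X) \<and>
     (\<forall>x\<in>vertices X. \<forall>y\<in>vertices X. edge_dist X (f x) (f y) = edge_dist X x y) \<and>
     (\<forall>a b. {a, b} \<in> J \<longrightarrow> f a = b)"

section \<open>Groups\<close>

definition cubical_action :: "('g, 'm) monoid_scheme \<Rightarrow> 'v set set \<Rightarrow> ('g \<Rightarrow> 'v \<Rightarrow> 'v) \<Rightarrow> bool" where
  "cubical_action G X \<phi> \<longleftrightarrow> group_action G (vertices X) \<phi> \<and>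
     (\<forall>g\<in>carrier G. cubical_automorphism X (\<phi> g))"

definition fundamental_domain ::
  "('g, 'm) monoid_scheme \<Rightarrow> 'v set set \<Rightarrow> ('g \<Rightarrow> 'v \<Rightarrow> 'v) \<Rightarrow> 'v set \<Rightarrow> bool" where
  "fundamental_domain G X \<phi> Y \<longleftrightarrow>
     Y \<subseteq> vertices X \<and> (\<forall>Z\<in>orbits G (vertices X) \<phi>. \<exists>!y. y \<in> Z \<inter> Y)"

definition internal_semidirect_product :: "('g, 'm) monoid_scheme \<Rightarrow> 'g set \<Rightarrow> 'g set \<Rightarrow> bool" where
  "internal_semidirect_product G N H \<longleftrightarrow>
     N \<lhd> G \<and> subgroup H G \<and> N \<inter> H = {\<one>\<^bsub>G\<^esub>} \<and> N <#>\<^bsub>G\<^esub> H = carrier G"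

text \<open>Group presentations. The letter \<open>(u, True)\<close> stands for the generator \<open>u\<close> and \<open>(u, False)\<close> for its
  formal inverse.\<close>

type_synonym 'a gword = "('a \<times> bool) list"

inductive word_equiv :: "'a gword set \<Rightarrow> 'a gword \<Rightarrow> 'a gword \<Rightarrow> bool" for R where
  refl: "word_equiv R w w"
| sym: "word_equiv R v w \<Longrightarrow> word_equiv R w v"
| trans: "word_equiv R u v \<Longrightarrow> word_equiv R v w \<Longrightarrow> word_equiv R u w"
| cancel: "word_equiv R (p @ [(u, s), (u, \<not> s)] @ q) (p @ q)"
| relator: "w \<in> R \<Longrightarrow> word_equiv R (p @ w @ q) (p @ q)"

definition word_rel :: "'a set \<Rightarrow> 'a gword set \<Rightarrow> ('a gword \<times> 'a gword) set" where
  "word_rel S R = {(v, w). v \<in> lists (S \<times> UNIV) \<and> w \<in> lists (S \<times> UNIV) \<and> word_equiv R v w}"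

definition presented_group :: "'a set \<Rightarrow> 'a gword set \<Rightarrow> 'a gword set monoid" where
  "presented_group S R =
     \<lparr>carrier = lists (S \<times> UNIV) // word_rel S R,
      monoid.mult = (\<lambda>A B. \<Union>v\<in>A. \<Union>w\<in>B. word_rel S R `` {v @ w}),
      one = word_rel S R `` {[]}\<rparr>"

definition presented_generator :: "'a set \<Rightarrow> 'a gword set \<Rightarrow> 'a \<Rightarrow> 'a gword set" where
  "presented_generator S R u = word_rel S R `` {[(u, True)]}"

text \<open>A graph is a pair of a vertex set and a set of two-element edges.\<close>

type_synonym 'a ugraph = "'a set \<times> 'a set set"

definition crossing_graph :: "'v set set \<Rightarrow> 'v set set set \<Rightarrow> 'v set set ugraph" where
  "crossing_graph X \<J> = (\<J>, {{J, K} |J K. J \<in> \<J> \<and> K \<in> \<J> \<and> transverse X J K})"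

definition racg_relators :: "'a ugraph \<Rightarrow> 'a gword set" where
  "racg_relators \<Delta> = {[(u, True), (u, True)] |u. u \<in> fst \<Delta>} \<union>
     {[(u, True), (v, True), (u, False), (v, False)] |u v. {u, v} \<in> snd \<Delta>}"

definition racg :: "'a ugraph \<Rightarrow> 'a gword set monoid" where
  "racg \<Delta> = presented_group (fst \<Delta>) (racg_relators \<Delta>)"

definition racg_generator :: "'a ugraph \<Rightarrow> 'a \<Rightarrow> 'a gword set" where
  "racg_generator \<Delta> = presented_generator (fst \<Delta>) (racg_relators \<Delta>)"

end

theory Submission
  imports Defs
begin

text \<open>A function on the vertices can be developed along edge paths as soon as its transport rule is
  compatible with backtracks and squares, because the complex is simply connected. With values in
  booleans this gives the two sides of a hyperplane. With values in \<open>R\<close>, multiplying by \<open>r J\<close> at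
  each crossing of \<open>J\<close>, it gives a map \<open>h\<close> such that \<open>h (g x) = g h(x)\<close> for \<open>g \<in> R\<close>, with \<open>h = 1\<close> on \<open>Y\<close> and
  \<open>h(x)\<^sup>-\<^sup>1 x \<in> Y\<close>; so \<open>Y\<close> is a fundamental domain. With values in the Coxeter group, reading a crossing of
  \<open>J\<close> at \<open>a\<close> as the generator \<open>h(a)\<^sup>-\<^sup>1 J\<close>, it gives a map \<open>H\<close> for which \<open>A \<mapsto> H(\<psi>(A) x\<^sub>0)\<close> is the identity
  of the Coxeter group, where \<open>\<psi>\<close> is the canonical homomorphism to \<open>R\<close>; so \<open>\<psi>\<close> is injective.

  Geometry enters through minimal galleries: reflecting part of a gallery that crosses a hyperplane
  twice shortens it. Hence \<open>Y\<close> is connected off the hyperplanes of \<open>\<J>\<close>, and a hyperplane of \<open>\<J>\<close> has a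
  dual edge at \<open>Y\<close> iff no other one separates it from \<open>x\<^sub>0\<close>.\<close>

section \<open>Edges and squares\<close>

lemma edge_vertices:
  assumes "{a, b} \<in> edges X"
  shows "a \<in> vertices X" "b \<in> vertices X" "a \<noteq> b"
  using assms by (auto simp: edges_def vertices_def)

lemma edge_doubleton:
  assumes "e \<in> edges X"
  obtains a b where "e = {a, b}" "a \<noteq> b"
  using assms by (auto simp: edges_def card_2_iff)

lemma atLeastAtMost_insert: "{A..insert x A} = {A, insert x A}"
  by auto

text \<open>Counting the \<open>2 ^ n\<close> vertices forces \<open>n = 2\<close>. Faces are images
  of intervals of subsets of \<open>{0, 1}\<close>; those with two vertices join subsets differing
  in one element, so the edges form a 4-cycle. The two diagonals do not occur, as no interval has
  just their ends.\<close>

lemma square_edges: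
  assumes "cube_complex X" "Q \<in> squares X"
  obtains a b c d where "distinct [a, b, c, d]" "Q = {a, b, c, d}"
    "{e \<in> edges X. e \<subseteq> Q} = {{a, b}, {b, c}, {c, d}, {d, a}}"
proof -
  have "Q \<in> X" and card: "card Q = 4"
    using assms(2) by (auto simp: squares_def)
  then obtain n and \<kappa> :: "nat set \<Rightarrow> 'a" where bij: "bij_betw \<kappa> (Pow {..<n}) Q"
    and faces: "{D \<in> X. D \<subseteq> Q} = {\<kappa> ` {A..B} |A B. A \<subseteq> B \<and> B \<subseteq> {..<n}}"
    using assms(1)[unfolded cube_complex_def, THEN conjunct1, rule_format, of Q] by auto
  have "(2::nat) ^ n = 2 ^ 2"
    using bij_betw_same_card[OF bij] card by (simp add: card_Pow)
  then have "n = 2"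
    by (simp only: power_inject_exp one_less_numeral_iff semiring_norm)
  then have n: "{..<n} = {0, 1}"
    by auto
  have pow: "Pow {..<n} = {{}, {0}, {1}, {0, 1}}"
    unfolding n by (auto simp: Pow_insert)
  let ?a = "\<kappa> {}" and ?b = "\<kappa> {0}" and ?c = "\<kappa> {0, 1}" and ?d = "\<kappa> {1}"
  have inj: "inj_on \<kappa> {{}, {0}, {1}, {0, 1}}" and Q: "Q = \<kappa> ` {{}, {0}, {1}, {0, 1}}"
    using bij unfolding pow bij_betw_def by simp_all
  have dist: "distinct [?a, ?b, ?c, ?d]"
    using inj by (simp add: inj_on_def insert_eq_iff) 
  have intervals: "{{}..{0}} = {{}, {0::nat}}" "{{0}..{0, 1}} = {{0}, {0, 1::nat}}"
    "{{1}..{0, 1}} = {{1}, {0, 1::nat}}" "{{}..{1}} = {{}, {1::nat}}"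
    "{{}..{0, 1}} = {{}, {0}, {1}, {0, 1::nat}}"
    using pow[unfolded n] atLeastAtMost_insert[of "{}" "0::nat"] atLeastAtMost_insert[of "{1::nat}" 0]
      atLeastAtMost_insert[of "{0::nat}" 1] atLeastAtMost_insert[of "{}" "1::nat"]
    by (simp_all add: insert_commute Pow_def atLeastAtMost_def atLeast_def atMost_def)
  have "{e \<in> edges X. e \<subseteq> Q} = {e \<in> {D \<in> X. D \<subseteq> Q}. card e = 2}"
    by (auto simp: edges_def)
  also have "\<dots> = {{?a, ?b}, {?b, ?c}, {?c, ?d}, {?d, ?a}}"
  proof (intro equalityI subsetI)
    fix e
    assume "e \<in> {e \<in> {D \<in> X. D \<subseteq> Q}. card e = 2}"
    then obtain A B where AB: "A \<subseteq> B" "B \<subseteq> {..<n}" and e: "e = \<kappa> ` {A..B}" "card e = 2"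
      unfolding faces by blast
    have "A \<in> Pow {..<n}" "B \<in> Pow {..<n}"
      using AB by auto
    then have "A \<in> {{}, {0}, {1}, {0, 1}}" "B \<in> {{}, {0}, {1}, {0, 1}}"
      by (simp_all only: pow)
    moreover have "A \<noteq> B"
      using e by auto
    moreover have "\<not> (A = {} \<and> B = {0, 1})"
    proof
      assume "A = {} \<and> B = {0, 1}"
      then have "e = {?a, ?b, ?d, ?c}"
        by (simp add: e(1) intervals del: One_nat_def)
      then show False
        using e(2) dist by simp
    qed
    ultimately have "(A = {} \<and> B = {0}) \<or> (A = {0} \<and> B = {0, 1}) \<or> (A = {1} \<and> B = {0, 1}) \<or> (A = {} \<and> B = {1})"
      using AB(1) by (elim insertE emptyE) simp_all
    then consider "A = {}" "B = {0}" | "A = {0}" "B = {0, 1}" | "A = {1}" "B = {0, 1}" | "A = {}" "B = {1}"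
      by argo
    then show "e \<in> {{?a, ?b}, {?b, ?c}, {?c, ?d}, {?d, ?a}}"
      by cases (simp_all add: e intervals doubleton_eq_iff del: One_nat_def)
  next
    fix e
    assume e: "e \<in> {{?a, ?b}, {?b, ?c}, {?c, ?d}, {?d, ?a}}"
    have "\<kappa> ` {A..B} \<in> {D \<in> X. D \<subseteq> Q}" if "A \<subseteq> B" "B \<subseteq> {0, 1}" for A B
      unfolding faces n using that by blast
    from this[of "{}" "{0}"] this[of "{0}" "{0, 1}"] this[of "{1}" "{0, 1}"] this[of "{}" "{1}"]
    have "{?a, ?b} \<in> {D \<in> X. D \<subseteq> Q}" "{?b, ?c} \<in> {D \<in> X. D \<subseteq> Q}"
      "{?d, ?c} \<in> {D \<in> X. D \<subseteq> Q}" "{?a, ?d} \<in> {D \<in> X. D \<subseteq> Q}"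
      by (simp_all only: intervals image_insert image_empty) auto
    then have "e \<in> {D \<in> X. D \<subseteq> Q}"
      using e by (elim insertE emptyE) (simp_all only: doubleton_eq_iff insert_commute)
    moreover have "card e = 2"
      using e dist by (elim insertE emptyE) (simp_all add: card_2_iff, blast+)
    ultimately show "e \<in> {e \<in> {D \<in> X. D \<subseteq> Q}. card e = 2}"
      by simp
  qed
  finally show thesis
    using that[OF dist] Q by (simp add: insert_commute)
qed

lemma square_edges_at:
  assumes X: "cube_complex X" and Q: "Q \<in> squares X" and e: "{a, b} \<in> edges X" "{a, b} \<subseteq> Q"
  obtains c d where "distinct [a, b, c, d]" "Q = {a, b, c, d}"
    "{e \<in> edges X. e \<subseteq> Q} = {{a, b}, {b, c}, {c, d}, {d, a}}"
proof -
  obtain p q s t where Q: "distinct [p, q, s, t]" "Q = {p, q, s, t}"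
    and edges: "{e \<in> edges X. e \<subseteq> Q} = {{p, q}, {q, s}, {s, t}, {t, p}}"
    using square_edges[OF X Q] by blast
  have "{a, b} \<in> {{p, q}, {q, s}, {s, t}, {t, p}}"
    using e unfolding edges[symmetric] by blast
  \<comment> \<open>Four edges with two orientations each: the eight symmetries of the square, each
    a rotation or reversal of the cyclic labelling.\<close>
  then consider "a = p" "b = q" | "a = q" "b = p" | "a = q" "b = s" | "a = s" "b = q"
    | "a = s" "b = t" | "a = t" "b = s" | "a = t" "b = p" | "a = p" "b = t"
    by (auto simp: doubleton_eq_iff)
  then show thesis
  proof cases
    case 1
    show thesis unfolding 1 by (rule that[of s t, unfolded 1, OF _ _ edges]) (use Q in auto)
  next
    case 2
    show thesis unfolding 2 by (rule that[of t s, unfolded 2, unfolded edges]) (use Q in auto)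
  next
    case 3
    show thesis unfolding 3 by (rule that[of t p, unfolded 3, unfolded edges]) (use Q in auto)
  next
    case 4
    show thesis unfolding 4 by (rule that[of p t, unfolded 4, unfolded edges]) (use Q in auto)
  next
    case 5
    show thesis unfolding 5 by (rule that[of p q, unfolded 5, unfolded edges]) (use Q in auto)
  next
    case 6
    show thesis unfolding 6 by (rule that[of q p, unfolded 6, unfolded edges]) (use Q in auto)
  next
    case 7
    show thesis unfolding 7 by (rule that[of q s, unfolded 7, unfolded edges]) (use Q in auto)
  next
    case 8
    show thesis unfolding 8 by (rule that[of s q, unfolded 8, unfolded edges]) (use Q in auto)
  qed
qed

section \<open>Developing maps\<close>

text \<open>Parallel transport of a state along a path: \<open>T a b\<close> is the update caused by
  the oriented edge from \<open>a\<close> to \<open>b\<close>. A single vertex causes none.\<close>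

fun transport :: "('v \<Rightarrow> 'v \<Rightarrow> 's \<Rightarrow> 's) \<Rightarrow> 'v list \<Rightarrow> 's \<Rightarrow> 's" where
  "transport T (a # b # p) s = transport T (b # p) (T a b s)"
| "transport T p s = s"

lemma transport_append:
  "transport T (p @ a # q) s = transport T (a # q) (transport T (p @ [a]) s)"
proof (induction p arbitrary: s)
  case (Cons b p)
  then show ?case by (cases p) auto
qed simp

lemma transport_join:
  "p \<noteq> [] \<Longrightarrow> q \<noteq> [] \<Longrightarrow> transport T (p @ q) s = transport T q (T (last p) (hd q) (transport T p s))"
proof (induction p arbitrary: s)
  case (Cons a p)
  then show ?case by (cases p; cases q) auto
qed simp

text \<open>The last two conditions are invariance under the two generating moves of
  \<open>edge_homotopic\<close>, that is, a flat connection. The set \<open>S\<close> allows values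
  in a part of a type, such as a subgroup, where alone the laws have to hold.\<close>

locale flat_transport =
  fixes X :: "'v set set" and T :: "'v \<Rightarrow> 'v \<Rightarrow> 's \<Rightarrow> 's" and S :: "'s set"
  assumes closed: "s \<in> S \<Longrightarrow> T a b s \<in> S"
    and inverse: "s \<in> S \<Longrightarrow> {a, b} \<in> edges X \<Longrightarrow> T b a (T a b s) = s"
    and square: "\<lbrakk>s \<in> S; {a, b, c, d} \<in> squares X; {a, b} \<in> edges X; {b, c} \<in> edges X;
      {a, d} \<in> edges X; {d, c} \<in> edges X\<rbrakk> \<Longrightarrow> T b c (T a b s) = T d c (T a d s)"
begin

lemma transport_closed: "s \<in> S \<Longrightarrow> transport T p s \<in> S"
proof (induction p arbitrary: s)
  case (Cons a p)
  then show ?case by (cases p) (auto intro: closed)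
qed simp

lemma transport_homotopic:
  "edge_homotopic X p q \<Longrightarrow> s \<in> S \<Longrightarrow> transport T p s = transport T q s"
proof (induction arbitrary: s rule: edge_homotopic.induct)
  case (backtrack a b p q)
  then show ?case
    using transport_append[of T p a "b # a # q"] transport_append[of T p a q]
    by (simp add: inverse transport_closed)
next
  case (square a b c d p q)
  then show ?case
    using transport_append[of T p a "b # c # q"] transport_append[of T p a "d # c # q"]
    by (simp add: flat_transport.square[OF flat_transport_axioms] transport_closed)
qed auto

lemma transport_rev:
  "successively (\<lambda>a b. {a, b} \<in> edges X) p \<Longrightarrow> s \<in> S \<Longrightarrow> transport T (rev p) (transport T p s) = s"
proof (induction p arbitrary: s)
  case (Cons a p)
  show ?case
  proof (cases p)
    case (Cons b q)
    then have e: "{a, b} \<in> edges X" and p: "successively (\<lambda>a b. {a, b} \<in> edges X) p"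
      using Cons.prems by auto
    have "transport T (rev (a # p)) (transport T (a # p) s) =
        T b a (transport T (rev p) (transport T p (T a b s)))"
      using transport_join[of "rev p" "[a]" T] Cons by (simp add: last_rev)
    also have "\<dots> = s"
      using Cons.IH[OF p] Cons.prems e by (simp add: closed inverse)
    finally show ?thesis .
  qed simp
qed simp

end

lemma edge_path_append:
  "edge_path X p \<Longrightarrow> edge_path X q \<Longrightarrow> {last p, hd q} \<in> edges X \<Longrightarrow> edge_path X (p @ q)"
  by (auto simp: edge_path_def successively_append_iff)

lemma edge_path_rev: "edge_path X p \<Longrightarrow> edge_path X (rev p)"
  by (auto simp: edge_path_def insert_commute)

lemma edge_connected_induct [consumes 3, case_names base step]:
  assumes "edge_connected X" "x \<in> vertices X" "y \<in> vertices X" "P x"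
    and step: "\<And>a b. {a, b} \<in> edges X \<Longrightarrow> P a \<Longrightarrow> P b"
  shows "P y"
proof -
  obtain p where p: "edge_path X p" "hd p = x" "last p = y"
    using assms unfolding edge_connected_def by blast
  have "successively (\<lambda>a b. {a, b} \<in> edges X) p \<Longrightarrow> p \<noteq> [] \<Longrightarrow> P (hd p) \<Longrightarrow> P (last p)"
  proof (induction p)
    case (Cons a p)
    then show ?case using step[of a "hd p"] by (cases p) auto
  qed simp
  then show ?thesis
    using p assms(4) by (auto simp: edge_path_def)
qed

text \<open>Transport along any chosen path from \<open>x\<close> to \<open>y\<close> defines
  \<open>F y\<close>. Simple connectedness contracts each loop at \<open>x\<close>, so its transport
  fixes \<open>s\<close> and the choice of path has no effect.\<close>

lemma (in flat_transport) developing_map: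
  assumes X: "edge_simply_connected X" and x: "x \<in> vertices X" and s: "s \<in> S"
  obtains F where "F x = s" "\<And>y. F y \<in> S" "\<And>a b. {a, b} \<in> edges X \<Longrightarrow> F b = T a b (F a)"
proof -
  define \<pi> where "\<pi> y = (SOME p. edge_path X p \<and> hd p = x \<and> last p = y)" for y
  define F where "F y = transport T (\<pi> y) s" for y
  have \<pi>: "edge_path X (\<pi> y)" "hd (\<pi> y) = x" "last (\<pi> y) = y" if "y \<in> vertices X" for y
  proof -
    have "\<exists>p. edge_path X p \<and> hd p = x \<and> last p = y"
      using X x that unfolding edge_simply_connected_def edge_connected_def by blast
    from someI_ex[OF this] show "edge_path X (\<pi> y)" "hd (\<pi> y) = x" "last (\<pi> y) = y"
      unfolding \<pi>_def by auto
  qed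
  have loop: "transport T p s = s" if "edge_path X p" "hd p = x" "last p = x" for p
    using transport_homotopic[of p "[x]" s] X s that unfolding edge_simply_connected_def by auto
  show thesis
  proof
    show "F x = s"
      unfolding F_def using \<pi>[OF x] by (intro loop)
    show "F y \<in> S" for y
      unfolding F_def by (rule transport_closed[OF s])
    fix a b
    assume e: "{a, b} \<in> edges X"
    note ab = edge_vertices[OF e]
    note a = \<pi>[OF ab(1)] and b = \<pi>[OF ab(2)]
    have ne: "\<pi> a \<noteq> []" "\<pi> b \<noteq> []"
      using a(1) b(1) by (auto simp: edge_path_def)
    \<comment> \<open>The loop goes to \<open>a\<close> along \<open>\<pi> a\<close>, crosses the
      edge and returns along \<open>\<pi> b\<close>. Undoing the return by
      \<open>transport_rev\<close> then compares \<open>F b\<close> with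
      \<open>T a b (F a)\<close>.\<close>
    have "transport T (rev (\<pi> b)) (T a b (F a)) = transport T (\<pi> a @ rev (\<pi> b)) s"
      using ne a b by (simp add: transport_join F_def hd_rev)
    also have "\<dots> = s"
      using ne a b e by (intro loop edge_path_append edge_path_rev) (auto simp: hd_rev last_rev)
    finally have *: "transport T (rev (\<pi> b)) (T a b (F a)) = s" .
    have "F b = transport T (rev (rev (\<pi> b))) (transport T (rev (\<pi> b)) (T a b (F a)))"
      unfolding * by (simp add: F_def)
    also have "\<dots> = T a b (F a)"
      using edge_path_rev[OF b(1)] s unfolding edge_path_def F_def
      by (intro transport_rev closed transport_closed) simp_all
    finally show "F b = T a b (F a)" .
  qed
qed

section \<open>Presented groups\<close>

definition word_class :: "'a set \<Rightarrow> 'a gword set \<Rightarrow> 'a gword \<Rightarrow> 'a gword set" where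
  "word_class S R w = word_rel S R `` {w}"

lemma equiv_word_rel: "equiv (lists (S \<times> UNIV)) (word_rel S R)"
  by (rule equivI)
    (auto simp: word_rel_def refl_on_def sym_def trans_def intro: word_equiv.intros)

lemma word_class_eqI:
  "v \<in> lists (S \<times> UNIV) \<Longrightarrow> w \<in> lists (S \<times> UNIV) \<Longrightarrow> word_equiv R v w \<Longrightarrow>
    word_class S R v = word_class S R w"
  unfolding word_class_def by (rule equiv_class_eq[OF equiv_word_rel]) (auto simp: word_rel_def)

lemma word_equiv_append:
  "word_equiv R v w \<Longrightarrow> word_equiv R (p @ v @ q) (p @ w @ q)"
proof (induction rule: word_equiv.induct)
  case (cancel p' u s q')
  then show ?case using word_equiv.cancel[of R "p @ p'" u s "q' @ q"] by simp
next
  case (relator w p' q')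
  then show ?case using word_equiv.relator[of w R "p @ p'" "q' @ q"] by simp
qed (auto intro: word_equiv.intros)

lemma carrier_presented_group:
  "carrier (presented_group S R) = word_class S R ` lists (S \<times> UNIV)"
  by (auto simp: presented_group_def quotient_def word_class_def)

text \<open>The product is defined as a union over all pairs of representatives. Compatibility of
  the equivalence with concatenation on both sides collapses this union to a single class.\<close>

lemma presented_group_mult:
  assumes "v \<in> lists (S \<times> UNIV)" "w \<in> lists (S \<times> UNIV)"
  shows "word_class S R v \<otimes>\<^bsub>presented_group S R\<^esub> word_class S R w = word_class S R (v @ w)"
proof -
  have "word_class S R (v' @ w') = word_class S R (v @ w)"
    if "(v, v') \<in> word_rel S R" "(w, w') \<in> word_rel S R" for v' w'
  proof (rule word_class_eqI)
    have "word_equiv R v' v" "word_equiv R w' w"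
      using that by (auto simp: word_rel_def intro: word_equiv.sym)
    then show "word_equiv R (v' @ w') (v @ w)"
      using word_equiv_append[of R v' v "[]" w'] word_equiv_append[of R w' w v "[]"]
      by (auto intro: word_equiv.trans)
  qed (use that in \<open>auto simp: word_rel_def\<close>)
  then have "word_class S R (v' @ w') = word_class S R (v @ w)"
    if "v' \<in> word_class S R v" "w' \<in> word_class S R w" for v' w'
    using that by (simp add: word_class_def)
  moreover have "v \<in> word_class S R v" "w \<in> word_class S R w"
    using assms by (auto simp: word_class_def word_rel_def intro: word_equiv.refl)
  ultimately have "(\<Union>v'\<in>word_class S R v. \<Union>w'\<in>word_class S R w. word_class S R (v' @ w')) =
      word_class S R (v @ w)"
    by blast
  then show ?thesis
    by (simp add: presented_group_def word_class_def)
qed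

fun word_eval :: "('g, 'm) monoid_scheme \<Rightarrow> ('a \<Rightarrow> 'g) \<Rightarrow> 'a gword \<Rightarrow> 'g" where
  "word_eval G f [] = \<one>\<^bsub>G\<^esub>"
| "word_eval G f ((u, s) # w) = (if s then f u else inv\<^bsub>G\<^esub> (f u)) \<otimes>\<^bsub>G\<^esub> word_eval G f w"

context group
begin

lemma word_eval_closed: "(\<And>u. f u \<in> carrier G) \<Longrightarrow> word_eval G f w \<in> carrier G"
  by (induction w) auto

lemma word_eval_append:
  "(\<And>u. f u \<in> carrier G) \<Longrightarrow> word_eval G f (v @ w) = word_eval G f v \<otimes> word_eval G f w"
  by (induction v) (auto simp: word_eval_closed m_assoc)

lemma word_eval_equiv:
  assumes f: "\<And>u. f u \<in> carrier G" and R: "\<And>w. w \<in> R \<Longrightarrow> word_eval G f w = \<one>"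
  shows "word_equiv R v w \<Longrightarrow> word_eval G f v = word_eval G f w"
proof (induction rule: word_equiv.induct)
  case (cancel p u s q)
  have "word_eval G f [(u, s), (u, \<not> s)] = \<one>"
    using f by simp
  then show ?case
    using f word_eval_append[of f "[(u, s), (u, \<not> s)]" q]
    by (simp add: word_eval_append word_eval_closed del: append_Cons)
qed (auto simp: word_eval_append word_eval_closed f R)

text \<open>Existence half of the universal property of a presentation: evaluation of words kills
  the relators and is therefore constant on classes, so any representative may be evaluated.\<close>

lemma presented_group_lift:
  assumes f: "\<And>u. f u \<in> carrier G" and R: "\<And>w. w \<in> R \<Longrightarrow> word_eval G f w = \<one>"
  obtains \<psi> where "\<psi> \<in> hom (presented_group S R) G"
    "\<And>w. w \<in> lists (S \<times> UNIV) \<Longrightarrow> \<psi> (word_class S R w) = word_eval G f w"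
proof -
  define \<psi> where "\<psi> A = word_eval G f (SOME w. w \<in> A)" for A
  have \<psi>: "\<psi> (word_class S R w) = word_eval G f w" if w: "w \<in> lists (S \<times> UNIV)" for w
  proof -
    have "w \<in> word_class S R w"
      using w by (auto simp: word_class_def word_rel_def intro: word_equiv.refl)
    then have "(SOME v. v \<in> word_class S R w) \<in> word_class S R w"
      by (rule someI)
    then have "(w, SOME v. v \<in> word_class S R w) \<in> word_rel S R"
      unfolding word_class_def by (rule Image_singleton_iff[THEN iffD1])
    then have "word_equiv R w (SOME v. v \<in> word_class S R w)"
      unfolding word_rel_def by blast
    then show ?thesis
      unfolding \<psi>_def by (simp only: word_eval_equiv[OF f R])
  qed
  show thesis
  proof
    show "\<psi> \<in> hom (presented_group S R) G"
      by (rule homI; unfold carrier_presented_group; elim imageE)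
        (simp_all add: carrier_presented_group presented_group_mult \<psi> f word_eval_closed word_eval_append)
  qed (rule \<psi>)
qed

end

section \<open>Right-angled Coxeter groups through right multiplication by generators\<close>

lemma racg_mult_generator:
  assumes "w \<in> lists (fst \<Delta> \<times> UNIV)" "u \<in> fst \<Delta>"
  shows "word_class (fst \<Delta>) (racg_relators \<Delta>) w \<otimes>\<^bsub>racg \<Delta>\<^esub> racg_generator \<Delta> u =
    word_class (fst \<Delta>) (racg_relators \<Delta>) (w @ [(u, True)])"
  using assms unfolding racg_def racg_generator_def presented_generator_def word_class_def[symmetric]
  by (intro presented_group_mult) auto

lemma carrier_racg:
  "carrier (racg \<Delta>) = word_class (fst \<Delta>) (racg_relators \<Delta>) ` lists (fst \<Delta> \<times> UNIV)"
  by (simp add: racg_def carrier_presented_group)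

lemma racg_one_closed: "\<one>\<^bsub>racg \<Delta>\<^esub> \<in> carrier (racg \<Delta>)"
  unfolding carrier_racg by (rule image_eqI[of _ _ "[]"]) (simp_all add: racg_def presented_group_def word_class_def)

lemma racg_generator_in_carrier: "u \<in> fst \<Delta> \<Longrightarrow> racg_generator \<Delta> u \<in> carrier (racg \<Delta>)"
  unfolding carrier_racg
  by (rule image_eqI[of _ _ "[(u, True)]"])
    (simp_all add: racg_generator_def presented_generator_def word_class_def)

lemma racg_generator_closed:
  "A \<in> carrier (racg \<Delta>) \<Longrightarrow> u \<in> fst \<Delta> \<Longrightarrow> A \<otimes>\<^bsub>racg \<Delta>\<^esub> racg_generator \<Delta> u \<in> carrier (racg \<Delta>)"
  unfolding carrier_racg
  by (elim imageE, rule image_eqI[of _ _ "_ @ [(u, True)]"]) (simp_all add: racg_mult_generator)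

lemma racg_generator_square:
  assumes "A \<in> carrier (racg \<Delta>)" "u \<in> fst \<Delta>"
  shows "A \<otimes>\<^bsub>racg \<Delta>\<^esub> racg_generator \<Delta> u \<otimes>\<^bsub>racg \<Delta>\<^esub> racg_generator \<Delta> u = A"
proof -
  obtain w where w: "w \<in> lists (fst \<Delta> \<times> UNIV)" "A = word_class (fst \<Delta>) (racg_relators \<Delta>) w"
    using assms(1) by (auto simp: carrier_racg)
  have "word_equiv (racg_relators \<Delta>) (w @ [(u, True), (u, True)] @ []) (w @ [])"
    using assms(2) by (intro word_equiv.relator) (auto simp: racg_relators_def)
  then show ?thesis
    using w(1) assms(2) unfolding w(2) by (simp add: racg_mult_generator word_class_eqI)
qed

lemma racg_generator_commute:
  assumes "A \<in> carrier (racg \<Delta>)" "u \<in> fst \<Delta>" "v \<in> fst \<Delta>" "{u, v} \<in> snd \<Delta>"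
  shows "A \<otimes>\<^bsub>racg \<Delta>\<^esub> racg_generator \<Delta> u \<otimes>\<^bsub>racg \<Delta>\<^esub> racg_generator \<Delta> v =
    A \<otimes>\<^bsub>racg \<Delta>\<^esub> racg_generator \<Delta> v \<otimes>\<^bsub>racg \<Delta>\<^esub> racg_generator \<Delta> u"
proof -
  obtain w where w: "w \<in> lists (fst \<Delta> \<times> UNIV)" "A = word_class (fst \<Delta>) (racg_relators \<Delta>) w"
    using assms(1) by (auto simp: carrier_racg)
  let ?c = "[(u, True), (v, True), (u, False), (v, False)]"
  \<comment> \<open>The commutator is inserted in front of \<open>v u\<close>. Deleted as a relator
    it leaves \<open>v u\<close>, while two free cancellations leave \<open>u v\<close>.\<close>
  have "word_equiv (racg_relators \<Delta>) (w @ ?c @ [(v, True), (u, True)]) (w @ [(v, True), (u, True)])"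
    using assms(4) by (intro word_equiv.relator) (auto simp: racg_relators_def)
  moreover have "word_equiv (racg_relators \<Delta>) (w @ ?c @ [(v, True), (u, True)])
      (w @ [(u, True), (v, True), (u, False), (u, True)])"
    using word_equiv.cancel[of _ "w @ [(u, True), (v, True), (u, False)]" v False "[(u, True)]"] by simp
  moreover have "word_equiv (racg_relators \<Delta>) (w @ [(u, True), (v, True), (u, False), (u, True)])
      (w @ [(u, True), (v, True)])"
    using word_equiv.cancel[of _ "w @ [(u, True), (v, True)]" u False "[]"] by simp
  ultimately have "word_equiv (racg_relators \<Delta>) (w @ [(u, True), (v, True)]) (w @ [(v, True), (u, True)])"
    by (meson word_equiv.sym word_equiv.trans)
  then show ?thesis
    using w(1) assms(2,3) unfolding w(2) by (simp add: racg_mult_generator word_class_eqI)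
qed

text \<open>Since \<open>u\<close> squares to one, a formal inverse letter may be replaced by the
  letter itself: the word for \<open>u\<close>-inverse, \<open>u\<close>, \<open>u\<close> reduces
  to \<open>u\<close> by cancellation and to \<open>u\<close>-inverse by the relator. Thus positive
  words reach every class.\<close>

lemma racg_induct [consumes 1, case_names one mult]:
  assumes "A \<in> carrier (racg \<Delta>)"
    and one: "P \<one>\<^bsub>racg \<Delta>\<^esub>"
    and mult: "\<And>A u. \<lbrakk>A \<in> carrier (racg \<Delta>); u \<in> fst \<Delta>; P A\<rbrakk> \<Longrightarrow> P (A \<otimes>\<^bsub>racg \<Delta>\<^esub> racg_generator \<Delta> u)"
  shows "P A"
proof -
  have "P (word_class (fst \<Delta>) (racg_relators \<Delta>) w)" if "w \<in> lists (fst \<Delta> \<times> UNIV)" for w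
    using that
  proof (induction w rule: rev_induct)
    case Nil
    then show ?case using one by (simp add: racg_def presented_group_def word_class_def)
  next
    case (snoc x w)
    then obtain u s where x: "x = (u, s)" and u: "u \<in> fst \<Delta>" by auto
    have w: "w \<in> lists (fst \<Delta> \<times> UNIV)"
      using snoc.prems by auto
    have "word_equiv (racg_relators \<Delta>) (w @ [(u, s)]) (w @ [(u, True)])"
    proof (cases s)
      case False
      have "word_equiv (racg_relators \<Delta>) ((w @ [(u, False)]) @ [(u, True), (u, True)] @ []) ((w @ [(u, False)]) @ [])"
        using u by (intro word_equiv.relator) (auto simp: racg_relators_def)
      moreover have "word_equiv (racg_relators \<Delta>) (w @ [(u, False), (u, True), (u, True)]) (w @ [(u, True)])"
        using word_equiv.cancel[of _ w u False "[(u, True)]"] by simp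
      ultimately show ?thesis
        using False by (auto intro: word_equiv.sym word_equiv.trans)
    qed (auto intro: word_equiv.refl)
    then have "word_class (fst \<Delta>) (racg_relators \<Delta>) (w @ [x]) =
        word_class (fst \<Delta>) (racg_relators \<Delta>) w \<otimes>\<^bsub>racg \<Delta>\<^esub> racg_generator \<Delta> u"
      unfolding x racg_mult_generator[OF w u] using w u by (intro word_class_eqI) auto
    then show ?case
      using mult[of "word_class (fst \<Delta>) (racg_relators \<Delta>) w" u] snoc.IH w u
      by (simp add: carrier_racg del: in_lists_conv_set)
  qed
  then show ?thesis
    using assms(1) by (auto simp: carrier_racg simp del: in_lists_conv_set)
qed

section \<open>Hyperplanes\<close>

lemma parallel_equiv: "equiv (edges X) (parallel X)"
proof (rule equivI)
  have "sym (opposite X)"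
    by (auto simp: sym_def opposite_def)
  then show "sym (parallel X)"
    unfolding parallel_def by (intro sym_Int sym_rtrancl) (auto simp: sym_def)
  show "trans (parallel X)"
    by (auto simp: parallel_def trans_def)
qed (auto simp: parallel_def refl_on_def)

lemma hyperplane_edge: "J \<in> hyperplanes X \<Longrightarrow> e \<in> J \<Longrightarrow> e \<in> edges X"
  unfolding hyperplanes_def using in_quotient_imp_subset[OF parallel_equiv] by blast

lemma hyperplane_nonempty: "J \<in> hyperplanes X \<Longrightarrow> J \<noteq> {}"
  unfolding hyperplanes_def by (rule in_quotient_imp_non_empty[OF parallel_equiv])

lemma hyperplane_unique:
  "J \<in> hyperplanes X \<Longrightarrow> K \<in> hyperplanes X \<Longrightarrow> e \<in> J \<Longrightarrow> e \<in> K \<Longrightarrow> J = K"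
  unfolding hyperplanes_def using quotient_disj[OF parallel_equiv] by blast

lemma hyperplane_opposite:
  assumes "J \<in> hyperplanes X" "e \<in> J" "(e, f) \<in> opposite X"
  shows "f \<in> J"
proof -
  have "(e, f) \<in> parallel X"
    using assms by (auto simp: parallel_def opposite_def)
  then show ?thesis
    using in_quotient_imp_closed[OF parallel_equiv] assms unfolding hyperplanes_def by blast
qed

lemma hyperplane_induct [consumes 3, case_names base step]:
  assumes "J \<in> hyperplanes X" "e \<in> J" "f \<in> J"
    and base: "P e"
    and step: "\<And>e f. \<lbrakk>e \<in> J; (e, f) \<in> opposite X; P e\<rbrakk> \<Longrightarrow> P f"
  shows "P f"
proof -
  have "(e, f) \<in> parallel X"
    using assms quotient_eq_iff[OF parallel_equiv] unfolding hyperplanes_def by blast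
  then have "(e, f) \<in> (opposite X)\<^sup>*"
    by (simp add: parallel_def)
  then have "f \<in> J \<and> P f"
    by induction (use assms hyperplane_opposite in blast)+
  then show ?thesis ..
qed

lemma square_opposite:
  assumes "{a, b, c, d} \<in> squares X" "{a, b} \<in> edges X" "{d, c} \<in> edges X"
  shows "({a, b}, {d, c}) \<in> opposite X"
proof -
  have "card {a, b, c, d} = 4"
    using assms(1) by (simp add: squares_def)
  then have "distinct [a, b, c, d]"
    by (intro card_distinct) simp
  then have "{a, b} \<inter> {d, c} = {}"
    by simp
  moreover have "\<exists>Q\<in>squares X. {a, b} \<subseteq> Q \<and> {d, c} \<subseteq> Q"
    by (intro bexI[OF _ assms(1)]) simp
  ultimately show ?thesis
    using assms(2,3) by (simp only: opposite_def mem_Collect_eq case_prod_conv simp_thms)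
qed

lemma opposite_square:
  assumes X: "cube_complex X" and opp: "({a, b}, f) \<in> opposite X"
  obtains c d where "f = {d, c}" "{a, d} \<in> edges X" "{b, c} \<in> edges X" "{a, b, c, d} \<in> squares X"
proof -
  obtain Q where Q: "Q \<in> squares X" "{a, b} \<in> edges X" "{a, b} \<subseteq> Q" and f: "f \<in> {e \<in> edges X. e \<subseteq> Q}"
    and disj: "{a, b} \<inter> f = {}"
    using opp by (auto simp: opposite_def)
  obtain c d where *: "distinct [a, b, c, d]" "Q = {a, b, c, d}"
    "{e \<in> edges X. e \<subseteq> Q} = {{a, b}, {b, c}, {c, d}, {d, a}}"
    by (rule square_edges_at[OF X Q])
  have "f = {d, c}"
    using f disj unfolding *(3) by auto
  moreover have "{b, c} \<in> edges X" "{d, a} \<in> edges X"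
    using *(3) by blast+
  ultimately show thesis
    using that[of d c] Q(1) *(2) by (simp add: insert_commute)
qed

lemma square_corner:
  assumes X: "cube_complex X" and Q: "Q \<in> squares X"
    and e: "e \<in> edges X" "e \<subseteq> Q" and f: "f \<in> edges X" "f \<subseteq> Q" and "e \<noteq> f" "e \<inter> f \<noteq> {}"
  obtains a b c d where "e = {a, b}" "f = {b, c}" "Q = {a, b, c, d}" "{a, d} \<in> edges X" "{d, c} \<in> edges X"
proof -
  obtain b where b: "b \<in> e" "b \<in> f"
    using assms(8) by (auto simp: disjoint_iff)
  obtain a where ab: "e = {a, b}" "a \<noteq> b"
  proof (rule edge_doubleton[OF e(1)])
    fix x y
    assume "e = {x, y}" "x \<noteq> y"
    then show thesis
      using that[of x] that[of y] b(1) by (auto simp: insert_commute)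
  qed
  obtain c d where *: "distinct [a, b, c, d]" "Q = {a, b, c, d}"
    "{e \<in> edges X. e \<subseteq> Q} = {{a, b}, {b, c}, {c, d}, {d, a}}"
    by (rule square_edges_at[OF X Q e[unfolded ab(1)]])
  have "f \<in> {{a, b}, {b, c}, {c, d}, {d, a}}"
    using f unfolding *(3)[symmetric] by simp
  then have "f = {b, c}"
    using ab b assms(7) *(1) by auto
  moreover have "{d, a} \<in> edges X" "{c, d} \<in> edges X"
    using *(3) by blast+
  ultimately show thesis
    using that[of a b c d] ab(1) *(2) by (simp add: insert_commute)
qed

section \<open>Halfspaces as reachability classes of the graph without the dual edges\<close>

definition off_hyperplane :: "'v set set \<Rightarrow> 'v set set \<Rightarrow> ('v \<times> 'v) set" where
  "off_hyperplane X J = {(a, b). {a, b} \<in> edges X - J}"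

lemma off_hyperplane_sym: "(x, y) \<in> (off_hyperplane X J)\<^sup>* \<Longrightarrow> (y, x) \<in> (off_hyperplane X J)\<^sup>*"
  by (rule sym_rtrancl[THEN symD]) (auto simp: sym_def off_hyperplane_def insert_commute)

lemma off_hyperplane_equiv:
  "equiv (vertices X) ((off_hyperplane X J)\<^sup>* \<inter> vertices X \<times> vertices X)"
  by (intro equivI sym_Int) (auto simp: refl_on_def trans_def sym_def off_hyperplane_sym)

text \<open>Halfspaces are equivalence classes, so the only one that contains \<open>x\<close> is
  the class of \<open>x\<close>; lying in it means being reachable from \<open>x\<close> off
  \<open>J\<close>.\<close>

lemma halfspace_intersection_iff:
  assumes "x \<in> vertices X"
  shows "y \<in> halfspace_intersection X \<J> x \<longleftrightarrow>
    y \<in> vertices X \<and> (\<forall>J\<in>\<J>. (x, y) \<in> (off_hyperplane X J)\<^sup>*)"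
proof -
  have "(\<forall>H\<in>halfspaces X J. x \<in> H \<longrightarrow> y \<in> H) \<longleftrightarrow> (x, y) \<in> (off_hyperplane X J)\<^sup>*"
    if y: "y \<in> vertices X" for J
  proof
    assume "\<forall>H\<in>halfspaces X J. x \<in> H \<longrightarrow> y \<in> H"
    then show "(x, y) \<in> (off_hyperplane X J)\<^sup>*"
      using quotientI[OF assms, of "(off_hyperplane X J)\<^sup>* \<inter> vertices X \<times> vertices X"] assms
      unfolding halfspaces_def off_hyperplane_def[symmetric] by auto
  next
    assume "(x, y) \<in> (off_hyperplane X J)\<^sup>*"
    then have "(x, y) \<in> (off_hyperplane X J)\<^sup>* \<inter> vertices X \<times> vertices X"
      using assms y by blast
    then show "\<forall>H\<in>halfspaces X J. x \<in> H \<longrightarrow> y \<in> H"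
      unfolding halfspaces_def off_hyperplane_def[symmetric]
      by (intro ballI impI) (rule in_quotient_imp_closed[OF off_hyperplane_equiv])
  qed
  then show ?thesis
    unfolding halfspace_intersection_def by blast
qed

text \<open>The parity of the number of times an edge path crosses a hyperplane is a homotopy invariant.\<close>

lemma hyperplane_sides:
  assumes X: "edge_simply_connected X" and J: "J \<in> hyperplanes X"
  obtains F :: "'v \<Rightarrow> bool" where "\<And>a b. {a, b} \<in> edges X \<Longrightarrow> F b = (F a \<noteq> ({a, b} \<in> J))"
proof (cases "vertices X = {}")
  case True
  then have "{a, b} \<notin> edges X" for a b
    using edge_vertices(1)[of a b X] by auto
  then show thesis
    by (intro that[of "\<lambda>_. True"]) simp
next
  case False
  then obtain x where x: "x \<in> vertices X" by blast
  have "flat_transport X (\<lambda>a b s. s \<noteq> ({a, b} \<in> J)) UNIV"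
  proof
    fix s :: bool and a b c d
    assume sq: "{a, b, c, d} \<in> squares X" "{a, b} \<in> edges X" "{b, c} \<in> edges X"
      "{a, d} \<in> edges X" "{d, c} \<in> edges X"
    \<comment> \<open>Opposite edges are dual to \<open>J\<close> together, so both ways around a
      square flip the boolean equally often.\<close>
    have "({a, b}, {d, c}) \<in> opposite X" "({d, c}, {a, b}) \<in> opposite X"
      "({b, c}, {a, d}) \<in> opposite X" "({a, d}, {b, c}) \<in> opposite X"
      using sq by (auto intro!: square_opposite simp: insert_commute)
    then have "{a, b} \<in> J \<longleftrightarrow> {d, c} \<in> J" "{b, c} \<in> J \<longleftrightarrow> {a, d} \<in> J"
      using hyperplane_opposite[OF J] by blast+
    then show "((s \<noteq> ({a, b} \<in> J)) \<noteq> ({b, c} \<in> J)) = ((s \<noteq> ({a, d} \<in> J)) \<noteq> ({d, c} \<in> J))"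
      by auto
  qed (auto simp: insert_commute)
  then show thesis
    by (rule flat_transport.developing_map[OF _ X x UNIV_I[of True]]) (rule that)
qed

section \<open>Groups containing reflections\<close>

abbreviation (input) translate :: "('g \<Rightarrow> 'v \<Rightarrow> 'v) \<Rightarrow> 'g \<Rightarrow> 'v set set \<Rightarrow> 'v set set" where
  "translate \<phi> g J \<equiv> (\<lambda>e. \<phi> g ` e) ` J"

locale reflection_action = group G for G :: "('g, 'm) monoid_scheme" (structure) +
  fixes X :: "'v set set" and \<phi> :: "'g \<Rightarrow> 'v \<Rightarrow> 'v" and \<J> :: "'v set set set"
    and r :: "'v set set \<Rightarrow> 'g" and x\<^sub>0 :: 'v
  assumes cube_complex: "cube_complex X"
    and simply_connected: "edge_simply_connected X"
    and action: "cubical_action G X \<phi>"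
    and free: "\<forall>x\<in>vertices X. stabilizer G \<phi> x = {\<one>}"
    and \<J>_hyperplanes: "\<J> \<subseteq> hyperplanes X"
    and \<J>_invariant: "\<forall>g\<in>carrier G. \<forall>J\<in>\<J>. translate \<phi> g J \<in> \<J>"
    and reflections: "\<forall>J\<in>\<J>. r J \<in> carrier G \<and> reflection X J (\<phi> (r J))"
    and x\<^sub>0: "x\<^sub>0 \<in> vertices X"
begin

abbreviation "V \<equiv> vertices X"
abbreviation "E \<equiv> edges X"
abbreviation "R \<equiv> generate G (r ` \<J>)"
abbreviation "Y \<equiv> halfspace_intersection X \<J> x\<^sub>0"
abbreviation "\<J>\<^sub>0 \<equiv> maximal_peripheral X x\<^sub>0 \<J>"

sublocale group_action G V \<phi>
  using action by (simp add: cubical_action_def)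

lemma edge_connected: "edge_connected X"
  using simply_connected by (simp add: edge_simply_connected_def)

lemma action_closed [simp]: "g \<in> carrier G \<Longrightarrow> x \<in> V \<Longrightarrow> \<phi> g x \<in> V"
  using element_image by blast

lemma action_mult: "g \<in> carrier G \<Longrightarrow> h \<in> carrier G \<Longrightarrow> x \<in> V \<Longrightarrow> \<phi> (g \<otimes> h) x = \<phi> g (\<phi> h x)"
  by (rule composition_rule)

lemma action_one [simp]: "x \<in> V \<Longrightarrow> \<phi> \<one> x = x"
  using id_eq_one by (metis restrict_apply')

lemma action_inv [simp]:
  assumes "g \<in> carrier G" "x \<in> V"
  shows "\<phi> (inv g) (\<phi> g x) = x" "\<phi> g (\<phi> (inv g) x) = x"
  using assms by (simp_all flip: action_mult)

text \<open>The quotient of the two elements fixes \<open>x\<close>, and stabilisers are trivial.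
  Identities in the group, such as \<open>r_involution\<close> and \<open>r_translate\<close>, can
  thus be checked at a single vertex.\<close>

lemma action_eqI:
  assumes "g \<in> carrier G" "h \<in> carrier G" "x \<in> V" "\<phi> g x = \<phi> h x"
  shows "g = h"
proof -
  have "\<phi> (inv h \<otimes> g) x = x"
    using assms by (simp add: action_mult)
  then have "inv h \<otimes> g \<in> stabilizer G \<phi> x"
    using assms by (simp add: stabilizer_def)
  then have "inv h \<otimes> g = \<one>"
    using free assms(3) by blast
  then show ?thesis
    using assms(1,2) by (metis inv_closed inv_equality inv_inv)
qed

lemma action_cubes: "g \<in> carrier G \<Longrightarrow> C \<in> X \<Longrightarrow> \<phi> g ` C \<in> X"
  using action by (auto simp: cubical_action_def cubical_automorphism_def)

lemma action_card:
  assumes "g \<in> carrier G" "C \<in> X"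
  shows "card (\<phi> g ` C) = card C"
proof (rule card_image)
  show "inj_on (\<phi> g) C"
    using inj_prop[OF assms(1)] by (rule inj_on_subset) (use assms in \<open>auto simp: vertices_def\<close>)
qed

lemma action_edge: "g \<in> carrier G \<Longrightarrow> {a, b} \<in> E \<Longrightarrow> {\<phi> g a, \<phi> g b} \<in> E"
  using action_cubes[of g "{a, b}"] action_card[of g "{a, b}"] by (simp add: edges_def)

lemma action_square: "g \<in> carrier G \<Longrightarrow> Q \<in> squares X \<Longrightarrow> \<phi> g ` Q \<in> squares X"
  by (simp add: squares_def action_cubes action_card)

lemma \<J>_hyperplane: "J \<in> \<J> \<Longrightarrow> J \<in> hyperplanes X"
  using \<J>_hyperplanes by blast

lemma \<J>_edge: "J \<in> \<J> \<Longrightarrow> e \<in> J \<Longrightarrow> e \<in> E"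
  by (rule hyperplane_edge[OF \<J>_hyperplane])

lemma \<J>_vertices:
  assumes "J \<in> \<J>" "{a, b} \<in> J"
  shows "a \<in> V" "b \<in> V"
  using edge_vertices[OF \<J>_edge[OF assms]] by auto

lemma \<J>_unique: "J \<in> \<J> \<Longrightarrow> K \<in> \<J> \<Longrightarrow> e \<in> J \<Longrightarrow> e \<in> K \<Longrightarrow> J = K"
  by (rule hyperplane_unique[OF \<J>_hyperplane \<J>_hyperplane])

lemma \<J>_edge_exists:
  assumes "J \<in> \<J>"
  obtains a b where "{a, b} \<in> J"
proof -
  obtain e where e: "e \<in> J"
    using hyperplane_nonempty[OF \<J>_hyperplane[OF assms]] by auto
  show thesis
    by (rule edge_doubleton[OF \<J>_edge[OF assms e]]) (use e that in blast)
qed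

lemma translate_closed: "g \<in> carrier G \<Longrightarrow> J \<in> \<J> \<Longrightarrow> translate \<phi> g J \<in> \<J>"
  using \<J>_invariant by blast

lemma translate_edge: "{a, b} \<in> J \<Longrightarrow> {\<phi> g a, \<phi> g b} \<in> translate \<phi> g J"
  by (rule image_eqI[of _ _ "{a, b}"]) auto

text \<open>Invariance puts the translate into \<open>\<J>\<close>, and two hyperplanes with a
  common dual edge coincide. A single edge therefore decides which hyperplane a translate
  is.\<close>

lemma translate_eqI:
  "\<lbrakk>g \<in> carrier G; J \<in> \<J>; K \<in> \<J>; {a, b} \<in> J; {\<phi> g a, \<phi> g b} \<in> K\<rbrakk> \<Longrightarrow> translate \<phi> g J = K"
  by (rule \<J>_unique[OF translate_closed _ translate_edge])

lemma translate_mult: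
  assumes "g \<in> carrier G" "h \<in> carrier G" "J \<in> \<J>"
  shows "translate \<phi> (g \<otimes> h) J = translate \<phi> g (translate \<phi> h J)"
proof -
  obtain a b where ab: "{a, b} \<in> J"
    using \<J>_edge_exists[OF assms(3)] by blast
  have "{\<phi> (g \<otimes> h) a, \<phi> (g \<otimes> h) b} \<in> translate \<phi> g (translate \<phi> h J)"
    using translate_edge[OF translate_edge[OF ab]] \<J>_vertices[OF assms(3) ab] assms
    by (simp add: action_mult)
  then show ?thesis
    using assms ab by (intro translate_eqI) (auto intro: translate_closed)
qed

lemma translate_one: "J \<in> \<J> \<Longrightarrow> translate \<phi> \<one> J = J"
  using \<J>_edge_exists[of J] \<J>_vertices by (metis action_one one_closed translate_eqI)

lemma translate_inv:
  "g \<in> carrier G \<Longrightarrow> J \<in> \<J> \<Longrightarrow> translate \<phi> (inv g) (translate \<phi> g J) = J"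
  "g \<in> carrier G \<Longrightarrow> J \<in> \<J> \<Longrightarrow> translate \<phi> g (translate \<phi> (inv g) J) = J"
  by (metis inv_closed l_inv translate_mult translate_one)
    (metis inv_closed r_inv translate_mult translate_one)

section \<open>The reflections and the normal subgroup they generate\<close>

lemma r_closed [simp]: "J \<in> \<J> \<Longrightarrow> r J \<in> carrier G"
  using reflections by blast

lemma r_swap:
  assumes "J \<in> \<J>" "{a, b} \<in> J"
  shows "\<phi> (r J) a = b" "\<phi> (r J) b = a"
  using reflections assms unfolding reflection_def by (auto simp: insert_commute)

lemma r_involution:
  assumes "J \<in> \<J>"
  shows "r J \<otimes> r J = \<one>"
proof -
  obtain a b where ab: "{a, b} \<in> J"
    using \<J>_edge_exists[OF assms] by blast
  show ?thesis
    by (rule action_eqI[of _ _ a]) (use assms ab \<J>_vertices in \<open>auto simp: action_mult r_swap[OF assms ab]\<close>)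
qed

lemma inv_r: "J \<in> \<J> \<Longrightarrow> inv (r J) = r J"
  using r_involution by (simp add: inv_equality)

text \<open>For an edge \<open>{a, b}\<close> dual to \<open>J\<close>, both sides send
  \<open>a\<close> to \<open>\<phi> g b\<close>, and freeness does the rest. This is the conjugation
  rule for reflections; it gives normality of \<open>R\<close> and the commutation of reflections in
  transverse hyperplanes.\<close>

lemma r_translate:
  assumes "g \<in> carrier G" "J \<in> \<J>"
  shows "r (translate \<phi> g J) \<otimes> g = g \<otimes> r J"
proof -
  obtain a b where ab: "{a, b} \<in> J"
    using \<J>_edge_exists[OF assms(2)] by blast
  note V = \<J>_vertices[OF assms(2) ab] and K = translate_closed[OF assms]
  show ?thesis
    by (rule action_eqI[of _ _ a])
      (use assms V K in \<open>simp_all add: action_mult r_swap[OF assms(2) ab] r_swap[OF K translate_edge[OF ab]]\<close>)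
qed

lemma R_closed: "R \<subseteq> carrier G"
  by (rule generate_incl) auto

lemma R_subgroup: "subgroup R G"
  by (rule generate_is_subgroup) auto

lemma r_in_R: "J \<in> \<J> \<Longrightarrow> r J \<in> R"
  by (auto intro: generate.incl)

lemma R_normal: "R \<lhd> G"
proof (rule normal_generateI)
  fix h g
  assume "h \<in> r ` \<J>" and g: "g \<in> carrier G"
  then obtain J where J: "J \<in> \<J>" "h = r J" by blast
  have "g \<otimes> h \<otimes> inv g = r (translate \<phi> g J)"
    using r_translate[OF g J(1)] g J translate_closed[OF g J(1)]
    by (metis inv_solve_right m_closed r_closed)
  then show "g \<otimes> h \<otimes> inv g \<in> r ` \<J>"
    using translate_closed[OF g J(1)] by simp
qed auto

lemma R_induct [consumes 1, case_names one mult]: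
  assumes "g \<in> R" and one: "P \<one>"
    and mult: "\<And>J g. J \<in> \<J> \<Longrightarrow> g \<in> R \<Longrightarrow> P g \<Longrightarrow> P (r J \<otimes> g)"
  shows "P g"
proof -
  \<comment> \<open>Quantifying over the right factor \<open>h\<close> makes the product case a
    composition of two left multiplications. Inverses of generators are generators because
    reflections are involutions.\<close>
  have "\<forall>h\<in>R. P h \<longrightarrow> P (g \<otimes> h)"
    using assms(1)
  proof (induction rule: generate.induct)
    case (inv h)
    then show ?case using mult inv_r by auto
  next
    case (eng g1 g2)
    show ?case
    proof (intro ballI impI)
      fix h
      assume h: "h \<in> R" "P h"
      then have "P (g1 \<otimes> (g2 \<otimes> h))"
        using eng by (auto intro: generate.eng)
      then show "P (g1 \<otimes> g2 \<otimes> h)"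
        using eng.hyps h(1) R_closed by (simp add: m_assoc subset_iff)
    qed
  qed (use mult R_closed in auto)
  then show ?thesis
    using one generate.one[of G "r ` \<J>"] assms(1) R_closed by (metis r_one subsetD)
qed

text \<open>The reflection along \<open>J\<close> swaps the two edges of the square that are dual to \<open>K\<close>.\<close>

lemma square_translate:
  assumes J: "J \<in> \<J>" "{a, b} \<in> J" and K: "K \<in> \<J>" "{b, c} \<in> K"
    and sq: "{a, b, c, d} \<in> squares X" and e: "{a, d} \<in> E" "{d, c} \<in> E"
  shows "{d, c} \<in> J" "{a, d} \<in> K" "translate \<phi> (r J) K = K"
proof -
  have *: "({a, b}, {d, c}) \<in> opposite X" "({b, c}, {a, d}) \<in> opposite X"
    using square_opposite[of a b c d X] square_opposite[of b c d a X] sq e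
      \<J>_edge[OF J] \<J>_edge[OF K] by (simp_all add: insert_commute)
  show dc: "{d, c} \<in> J" and ad: "{a, d} \<in> K"
    using hyperplane_opposite[OF \<J>_hyperplane] J K * by blast+
  show "translate \<phi> (r J) K = K"
    by (rule translate_eqI[of _ _ _ a d])
      (use J K dc ad in \<open>simp_all add: r_swap[OF J] r_swap[OF J(1) dc]\<close>)
qed

text \<open>The two edges supplied by \<open>transverse\<close> share a corner: they are distinct,
  and disjoint edges of a square would be opposite and so dual to one hyperplane. At the corner
  \<open>square_translate\<close> applies.\<close>

lemma transverse_translate:
  assumes "J \<in> \<J>" "K \<in> \<J>" "transverse X J K"
  shows "translate \<phi> (r J) K = K"
proof -
  obtain Q e f where Q: "Q \<in> squares X" and e: "e \<in> J" "e \<subseteq> Q" and f: "f \<in> K" "f \<subseteq> Q" and ne: "J \<noteq> K"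
    using assms(3) unfolding transverse_def by blast
  have E: "e \<in> E" "f \<in> E"
    using e f \<J>_edge assms by auto
  have "e \<noteq> f"
    using \<J>_unique assms(1,2) e f ne by blast
  moreover have "e \<inter> f \<noteq> {}"
  proof
    assume "e \<inter> f = {}"
    then have "(e, f) \<in> opposite X"
      using E Q e f unfolding opposite_def by blast
    then have "f \<in> J"
      using hyperplane_opposite[OF \<J>_hyperplane] assms(1) e by blast
    then show False
      using \<J>_unique[of J K f] assms f ne by simp
  qed
  ultimately obtain a b c d where *: "e = {a, b}" "f = {b, c}" "Q = {a, b, c, d}" "{a, d} \<in> E" "{d, c} \<in> E"
    by (rule square_corner[OF cube_complex Q E(1) e(2) E(2) f(2)])
  show ?thesis
    by (rule square_translate(3)[of J a b K c d]) (use * e f Q assms in simp_all)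
qed

lemma transverse_square:
  assumes "J \<in> \<J>" "{a, b} \<in> J" "{b, c} \<in> K" "{a, b, c, d} \<in> squares X" "g \<in> carrier G" "K \<in> \<J>"
  shows "transverse X (translate \<phi> g J) (translate \<phi> g K)"
proof -
  have "card {a, b, c, d} = 4"
    using assms by (simp add: squares_def)
  then have "distinct [a, b, c, d]"
    by (intro card_distinct) simp
  \<comment> \<open>If \<open>J = K\<close>, the reflection would send \<open>b\<close> both to
    \<open>a\<close> and to \<open>c\<close>, which are distinct vertices of the square.\<close>
  then have "J \<noteq> K"
    using r_swap(2)[of J a b] r_swap(1)[of J b c] assms by auto
  then have "translate \<phi> g J \<noteq> translate \<phi> g K"
    using translate_inv(1) assms by metis
  moreover have "{\<phi> g a, \<phi> g b} \<subseteq> \<phi> g ` {a, b, c, d}" "{\<phi> g b, \<phi> g c} \<subseteq> \<phi> g ` {a, b, c, d}"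
    by auto
  ultimately show ?thesis
    unfolding transverse_def
    by (intro conjI bexI[OF _ action_square[OF assms(5,4)]] bexI[OF _ translate_edge[OF assms(2)]]
        bexI[OF _ translate_edge[OF assms(3)]])
qed

subsection \<open>Galleries\<close>

text \<open>The index counts only the crossings of hyperplanes of \<open>\<J>\<close>; all other
  edges are free. The classes of \<open>gallery 0\<close> play the role of chambers, and
  \<open>gdist\<close> is the resulting chamber distance.\<close>

inductive gallery :: "nat \<Rightarrow> 'v \<Rightarrow> 'v \<Rightarrow> bool" where
  refl: "x \<in> V \<Longrightarrow> gallery 0 x x"
| stay: "gallery n x y \<Longrightarrow> {y, z} \<in> E \<Longrightarrow> \<forall>J\<in>\<J>. {y, z} \<notin> J \<Longrightarrow> gallery n x z"
| cross: "gallery n x y \<Longrightarrow> J \<in> \<J> \<Longrightarrow> {y, z} \<in> J \<Longrightarrow> gallery (Suc n) x z"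

definition gdist :: "'v \<Rightarrow> 'v \<Rightarrow> nat" where
  "gdist x y = (LEAST n. gallery n x y)"

lemma gallery_vertices: "gallery n x y \<Longrightarrow> x \<in> V \<and> y \<in> V"
  by (induction rule: gallery.induct) (auto dest: edge_vertices \<J>_edge)

lemma gallery_step:
  "\<lbrakk>J \<in> \<J>; {x, y} \<in> J\<rbrakk> \<Longrightarrow> gallery (Suc 0) x y"
  using gallery.cross[OF gallery.refl] \<J>_vertices by blast

lemma gallery_trans: "gallery n y z \<Longrightarrow> gallery m x y \<Longrightarrow> gallery (m + n) x z"
  by (induction rule: gallery.induct) (auto intro: gallery.intros)

lemma gallery_sym: "gallery n x y \<Longrightarrow> gallery n y x"
proof (induction rule: gallery.induct)
  case (stay n x y z)
  then have "gallery 0 z y"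
    using gallery.stay[OF gallery.refl, of z y] edge_vertices(2)[of y z] by (simp add: insert_commute)
  with stay.IH show ?case
    using gallery_trans by fastforce
next
  case (cross n x y J z)
  then have "gallery (Suc 0) z y"
    by (intro gallery_step[of J]) (simp_all add: insert_commute)
  with cross.IH show ?case
    using gallery_trans by fastforce
qed (rule gallery.refl)

lemma gallery_exists:
  assumes "x \<in> V" "y \<in> V"
  shows "\<exists>n. gallery n x y"
  using edge_connected assms(1,2)
proof (induction rule: edge_connected_induct)
  case base
  show ?case using gallery.refl[OF assms(1)] by blast
next
  case (step a b)
  then show ?case by (cases "\<forall>J\<in>\<J>. {a, b} \<notin> J") (blast intro: gallery.intros)+
qed

lemma translate_stay:
  assumes g: "g \<in> carrier G" and e: "{a, b} \<in> E" "\<forall>J\<in>\<J>. {a, b} \<notin> J"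
  shows "\<forall>J\<in>\<J>. {\<phi> g a, \<phi> g b} \<notin> J"
proof (intro ballI notI)
  fix J
  assume J: "J \<in> \<J>" "{\<phi> g a, \<phi> g b} \<in> J"
  then have "{a, b} \<in> translate \<phi> (inv g) J"
    using translate_edge[of "\<phi> g a" "\<phi> g b" J "inv g"] edge_vertices[OF e(1)] g by simp
  then show False
    using e(2) translate_closed[OF inv_closed[OF g] J(1)] by blast
qed

lemma gallery_translate:
  assumes g: "g \<in> carrier G"
  shows "gallery n x y \<Longrightarrow> gallery n (\<phi> g x) (\<phi> g y)"
proof (induction rule: gallery.induct)
  case (stay n x y z)
  show ?case
    by (rule gallery.stay[OF stay.IH action_edge[OF g stay.hyps(2)] translate_stay[OF g stay.hyps(2,3)]])
next
  case (cross n x y J z)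
  then show ?case
    using gallery.cross[OF cross.IH translate_closed[OF g] translate_edge] by blast
qed (use g in \<open>auto intro: gallery.refl\<close>)

lemma gdist_gallery: "x \<in> V \<Longrightarrow> y \<in> V \<Longrightarrow> gallery (gdist x y) x y"
  unfolding gdist_def by (rule LeastI_ex[OF gallery_exists])

lemma gdist_le: "gallery n x y \<Longrightarrow> gdist x y \<le> n"
  unfolding gdist_def by (rule Least_le)

lemma gdist_sym: "x \<in> V \<Longrightarrow> y \<in> V \<Longrightarrow> gdist x y = gdist y x"
  by (rule antisym; rule gdist_le; rule gallery_sym; rule gdist_gallery; assumption)

lemma gallery_last:
  assumes "gallery (Suc n) x y"
  obtains J u v where "J \<in> \<J>" "gallery n x u" "{u, v} \<in> J" "gallery 0 v y"
proof -
  have "n = Suc k \<Longrightarrow> \<exists>J u v. J \<in> \<J> \<and> gallery k x u \<and> {u, v} \<in> J \<and> gallery 0 v y"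
    if "gallery n x y" for n k x y
    using that
  proof (induction rule: gallery.induct)
    case (stay n x y z)
    then show ?case
      by (metis gallery.stay)
  next
    case (cross n x y J z)
    then show ?case
      using gallery.refl[of z] \<J>_vertices[of J y z] by auto
  qed simp
  then show thesis
    using assms that by blast
qed

section \<open>Sides of a hyperplane and minimal galleries\<close>

definition sides :: "'v set set \<Rightarrow> ('v \<Rightarrow> bool) \<Rightarrow> bool" where
  "sides J F \<longleftrightarrow> (\<forall>a b. {a, b} \<in> E \<longrightarrow> F b = (F a \<noteq> ({a, b} \<in> J)))"

lemma sides_exist:
  assumes "J \<in> \<J>"
  obtains F where "sides J F"
  using hyperplane_sides[OF simply_connected \<J>_hyperplane[OF assms]] unfolding sides_def by metis

lemma sides_cross: "sides J F \<Longrightarrow> J \<in> \<J> \<Longrightarrow> {a, b} \<in> J \<Longrightarrow> F b \<longleftrightarrow> \<not> F a"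
  using \<J>_edge unfolding sides_def by blast

lemma sides_stay: "sides J F \<Longrightarrow> {a, b} \<in> E \<Longrightarrow> {a, b} \<notin> J \<Longrightarrow> F b \<longleftrightarrow> F a"
  unfolding sides_def by blast

text \<open>The colour changes only at dual edges, so two vertices of different colours are
  certified to lie in different halfspaces.\<close>

lemma sides_off:
  assumes "sides J F"
  shows "(x, y) \<in> (off_hyperplane X J)\<^sup>* \<Longrightarrow> F x \<longleftrightarrow> F y"
  by (induction rule: rtrancl_induct) (use assms in \<open>auto simp: off_hyperplane_def dest: sides_stay\<close>)

lemma gallery_off:
  "gallery n x y \<Longrightarrow> n = 0 \<Longrightarrow> J \<in> \<J> \<Longrightarrow> (x, y) \<in> (off_hyperplane X J)\<^sup>*"
  by (induction rule: gallery.induct)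
    (auto simp: off_hyperplane_def intro: rtrancl.rtrancl_into_rtrancl)

lemma gallery_split:
  assumes F: "sides J F" and J: "J \<in> \<J>"
  shows "gallery n x y \<Longrightarrow> F x \<noteq> F y \<Longrightarrow>
    \<exists>u v i j. gallery i x u \<and> {u, v} \<in> J \<and> gallery j v y \<and> n = Suc (i + j)"
proof (induction rule: gallery.induct)
  case (stay n x y z)
  then have "F x \<noteq> F y"
    using sides_stay[OF F] J by blast
  then show ?case
    using stay gallery.stay by metis
next
  case (cross n x y K z)
  show ?case
  proof (cases "F x = F y")
    case True
    then have "{y, z} \<in> J"
      using cross sides_stay[OF F \<J>_edge[OF cross.hyps(2,3)]] by blast
    then show ?thesis
      using cross gallery.refl[of z] \<J>_vertices[OF J] by (metis add.right_neutral)
  next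
    case False
    then obtain u v i j where "gallery i x u" "{u, v} \<in> J" "gallery j v y" "n = Suc (i + j)"
      using cross.IH by blast
    then show ?thesis
      using gallery.cross[OF _ cross.hyps(2,3)] by (metis add_Suc_right)
  qed
qed simp

text \<open>Reflecting the initial part of a gallery along the hyperplane it crosses saves that crossing.\<close>

lemma gdist_less:
  assumes F: "sides J F" and J: "J \<in> \<J>" and e: "{a, b} \<in> J" and y: "y \<in> V" and ne: "F a \<noteq> F y"
  shows "gdist b y < gdist a y"
proof -
  obtain u v i j where *: "gallery i a u" "{u, v} \<in> J" "gallery j v y" "gdist a y = Suc (i + j)"
    using gallery_split[OF F J gdist_gallery[OF \<J>_vertices(1)[OF J e] y] ne] by blast
  have "gallery i b v"
    using gallery_translate[OF r_closed[OF J] *(1)] by (simp add: r_swap[OF J e] r_swap[OF J *(2)])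
  then have "gdist b y \<le> i + j"
    using gallery_trans[OF *(3)] gdist_le by blast
  then show ?thesis
    using *(4) by simp
qed

text \<open>Cut a minimal gallery at its last crossing, from \<open>u\<close> to \<open>v\<close>.
  If \<open>J\<close> did not separate \<open>x\<^sub>0\<close> from \<open>y\<close>, then
  \<open>u\<close> would lie across \<open>J\<close> from \<open>x\<^sub>0\<close>, so
  \<open>gdist_less\<close> would make \<open>v\<close> closer than \<open>u\<close>. As
  \<open>v\<close> reaches \<open>y\<close> for free, the gallery would not be minimal.\<close>

lemma gdist_last:
  assumes y: "y \<in> V" and "gdist x\<^sub>0 y \<noteq> 0"
  obtains J u v F where "J \<in> \<J>" "{u, v} \<in> J" "gallery 0 v y" "gdist x\<^sub>0 u < gdist x\<^sub>0 y"
    "sides J F" "F x\<^sub>0 \<noteq> F y"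
proof -
  obtain n where n: "gdist x\<^sub>0 y = Suc n"
    using assms(2) not0_implies_Suc by blast
  then have "gallery (Suc n) x\<^sub>0 y"
    using gdist_gallery[OF x\<^sub>0 y] by simp
  then obtain J u v where J: "J \<in> \<J>" and u: "gallery n x\<^sub>0 u" and e: "{u, v} \<in> J" and v: "gallery 0 v y"
    by (rule gallery_last)
  obtain F where F: "sides J F"
    by (rule sides_exist[OF J])
  note uv = \<J>_vertices[OF J e]
  have vy: "F v = F y"
    using sides_off[OF F gallery_off[OF v _ J]] by simp
  have "F x\<^sub>0 \<noteq> F y"
  proof
    assume "F x\<^sub>0 = F y"
    then have "F u \<noteq> F x\<^sub>0"
      using vy sides_cross[OF F J e] by blast
    then have "gdist v x\<^sub>0 < gdist u x\<^sub>0"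
      by (rule gdist_less[OF F J e x\<^sub>0])
    then have "gdist x\<^sub>0 v < n"
      using gdist_le[OF u] gdist_sym[OF x\<^sub>0] uv by simp
    moreover have "gdist x\<^sub>0 y \<le> gdist x\<^sub>0 v + 0"
      by (rule gdist_le[OF gallery_trans[OF v gdist_gallery[OF x\<^sub>0 uv(2)]]])
    ultimately show False
      using n by simp
  qed
  moreover have "gdist x\<^sub>0 u < gdist x\<^sub>0 y"
    using gdist_le[OF u] n by simp
  ultimately show thesis
    using that J e v F by blast
qed

text \<open>Membership in \<open>Y\<close> gives, for each hyperplane separately, some path avoiding
  it. One path avoiding all of them exists since the last hyperplane crossed by a minimal gallery
  separates its ends, which no hyperplane of \<open>\<J>\<close> does here.\<close>

lemma Y_iff_gallery: "y \<in> Y \<longleftrightarrow> gallery 0 x\<^sub>0 y"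
proof
  assume "y \<in> Y"
  then have y: "y \<in> V" "\<forall>J\<in>\<J>. (x\<^sub>0, y) \<in> (off_hyperplane X J)\<^sup>*"
    unfolding halfspace_intersection_iff[OF x\<^sub>0] by auto
  have "gdist x\<^sub>0 y = 0"
  proof (rule ccontr)
    assume "gdist x\<^sub>0 y \<noteq> 0"
    then show False
      by (rule gdist_last[OF y(1)]) (use y(2) sides_off in blast)
  qed
  then show "gallery 0 x\<^sub>0 y"
    using gdist_gallery[OF x\<^sub>0 y(1)] by simp
next
  assume "gallery 0 x\<^sub>0 y"
  then show "y \<in> Y"
    unfolding halfspace_intersection_iff[OF x\<^sub>0] using gallery_vertices gallery_off by blast
qed

section \<open>The walls of the chamber of the basepoint\<close>

lemma x\<^sub>0_in_Y: "x\<^sub>0 \<in> Y"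
  unfolding Y_iff_gallery by (rule gallery.refl[OF x\<^sub>0])

lemma Y_vertices: "Y \<subseteq> V"
  by (auto simp: halfspace_intersection_def)

text \<open>A hyperplane separating \<open>x\<^sub>0\<close> from \<open>J\<close> would separate it
  from \<open>a\<close>, but \<open>a\<close> shares the halfspaces of
  \<open>x\<^sub>0\<close>.\<close>

lemma panel_peripheral:
  assumes J: "J \<in> \<J>" "{a, b} \<in> J" and a: "a \<in> Y"
  shows "J \<in> \<J>\<^sub>0"
proof -
  have False if K: "K \<in> \<J>" "H \<in> halfspaces X K" "x\<^sub>0 \<notin> H" "\<Union>J \<subseteq> H" for K H
  proof -
    have a_H: "a \<in> H"
      using K(4) J(2) by blast
    have a_x: "(a, x\<^sub>0) \<in> (off_hyperplane X K)\<^sup>* \<inter> V \<times> V"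
      using a K(1) x\<^sub>0 unfolding halfspace_intersection_iff[OF x\<^sub>0] by (simp add: off_hyperplane_sym)
    have "x\<^sub>0 \<in> H"
      by (rule in_quotient_imp_closed[OF off_hyperplane_equiv _ a_H a_x])
        (rule K(2)[unfolded halfspaces_def, folded off_hyperplane_def])
    with K(3) show False ..
  qed
  then show ?thesis
    using J(1) unfolding maximal_peripheral_def separates_def by blast
qed

lemma \<J>_edge_at:
  assumes J: "J \<in> \<J>" and x: "x \<in> \<Union>J"
  obtains y where "{x, y} \<in> J"
proof -
  obtain e where e: "e \<in> J" "x \<in> e"
    using x by blast
  show thesis
  proof (rule edge_doubleton[OF \<J>_edge[OF J e(1)]])
    fix a b
    assume "e = {a, b}"
    then show thesis
      using e that[of a] that[of b] by (auto simp: insert_commute)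
  qed
qed

text \<open>A chain of squares links any two dual edges of \<open>J\<close>. No square of the chain
  has an edge in \<open>K\<close>, since that would make \<open>K\<close> and \<open>J\<close>
  transverse; so the rails of this ladder, and its rungs, avoid \<open>K\<close>.\<close>

lemma halfspace_of_hyperplane:
  assumes J: "J \<in> \<J>" and K: "K \<in> \<J>" and ne: "K \<noteq> J" "\<not> transverse X K J" and z: "z \<in> \<Union>J" and y: "y \<in> \<Union>J"
  shows "(z, y) \<in> (off_hyperplane X K)\<^sup>*"
proof -
  have off: "(a, b) \<in> off_hyperplane X K" if "{a, b} \<in> J" for a b
    using that \<J>_edge[OF J] \<J>_unique[OF J K] ne(1) by (auto simp: off_hyperplane_def)
  obtain z' where e: "{z, z'} \<in> J"
    by (rule \<J>_edge_at[OF J z])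
  obtain y' where f: "{y, y'} \<in> J"
    by (rule \<J>_edge_at[OF J y])
  have "\<forall>w\<in>{y, y'}. (z, w) \<in> (off_hyperplane X K)\<^sup>*"
    using \<J>_hyperplane[OF J] e f
  proof (induction rule: hyperplane_induct)
    case base
    then show ?case using off[OF e] by auto
  next
    case (step e f)
    obtain a b where e: "e = {a, b}"
      using edge_doubleton[OF \<J>_edge[OF J step.hyps(1)]] by blast
    obtain c d where f: "f = {d, c}" and sq: "{a, d} \<in> E" "{b, c} \<in> E" "{a, b, c, d} \<in> squares X"
      using step.hyps(2) unfolding e by (rule opposite_square[OF cube_complex])
    have "k \<notin> K" if "k \<subseteq> {a, b, c, d}" for k
    proof
      assume "k \<in> K"
      moreover have "{a, b} \<subseteq> {a, b, c, d}" "{a, b} \<in> J"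
        using step.hyps(1) e by auto
      ultimately have "transverse X K J"
        unfolding transverse_def using ne(1) sq(3) that by (intro conjI bexI)
      with ne(2) show False ..
    qed
    then have "{a, d} \<notin> K" "{b, c} \<notin> K"
      by simp_all
    then have "(a, d) \<in> off_hyperplane X K" "(b, c) \<in> off_hyperplane X K"
      using sq by (auto simp: off_hyperplane_def)
    then show ?case
      using step.IH unfolding e f by (auto intro: rtrancl.rtrancl_into_rtrancl)
  qed
  then show ?thesis by simp
qed

text \<open>Let \<open>z\<close> be an endpoint of a dual edge of \<open>J\<close> nearest to
  \<open>x\<^sub>0\<close> for \<open>gdist\<close>. If the distance is positive, let
  \<open>K\<close> be the last hyperplane crossed on the way. If \<open>K = J\<close> or
  \<open>K\<close> is transverse to \<open>J\<close>, there is a nearer endpoint; otherwise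
  \<open>K\<close> separates \<open>x\<^sub>0\<close> from \<open>J\<close>.\<close>

lemma peripheral_panel:
  assumes "J \<in> \<J>\<^sub>0"
  obtains a b where "{a, b} \<in> J" "a \<in> Y"
proof -
  have J: "J \<in> \<J>" and peripheral: "\<And>K. K \<in> \<J> \<Longrightarrow> \<not> separates X x\<^sub>0 K J"
    using assms by (auto simp: maximal_peripheral_def)
  have JV: "y \<in> V" if "y \<in> \<Union>J" for y
    using that \<J>_edge[OF J] by (auto simp: edges_def vertices_def)
  obtain a b where "{a, b} \<in> J"
    by (rule \<J>_edge_exists[OF J])
  then have "a \<in> \<Union>J" by blast
  then obtain z where z: "z \<in> \<Union>J" and least: "\<And>y. y \<in> \<Union>J \<Longrightarrow> gdist x\<^sub>0 z \<le> gdist x\<^sub>0 y"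
    using ex_has_least_nat[of "\<lambda>y. y \<in> \<Union>J" a "gdist x\<^sub>0"] by blast
  have "gdist x\<^sub>0 z = 0"
  proof (rule ccontr)
    assume "gdist x\<^sub>0 z \<noteq> 0"
    then obtain K u v F where K: "K \<in> \<J>" and e: "{u, v} \<in> K" and v: "gallery 0 v z"
      and u: "gdist x\<^sub>0 u < gdist x\<^sub>0 z" and F: "sides K F" "F x\<^sub>0 \<noteq> F z"
      by (rule gdist_last[OF JV[OF z]])
    note uv = \<J>_vertices[OF K e]
    have ne: "K \<noteq> J"
      using least[of u] u e by auto
    moreover have ntr: "\<not> transverse X K J"
    proof
      assume "transverse X K J"
      then have "translate \<phi> (r K) J = J"
        by (rule transverse_translate[OF K J])
      then have "\<phi> (r K) z \<in> \<Union>J"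
        using z by (metis UnionE UnionI image_eqI)
      \<comment> \<open>The reflection carries the free tail from \<open>v\<close> to
        \<open>z\<close> onto one starting at \<open>u\<close>, before the crossing of
        \<open>K\<close>, while keeping the end on \<open>J\<close>.\<close>
      moreover have "gallery 0 u (\<phi> (r K) z)"
        using gallery_translate[OF r_closed[OF K] v] by (simp add: r_swap[OF K e])
      then have "gdist x\<^sub>0 (\<phi> (r K) z) \<le> gdist x\<^sub>0 u + 0"
        by (rule gdist_le[OF gallery_trans[OF _ gdist_gallery[OF x\<^sub>0 uv(1)]]])
      ultimately show False
        using least u by fastforce
    qed
    moreover have "\<exists>H\<in>halfspaces X K. x\<^sub>0 \<notin> H \<and> \<Union>J \<subseteq> H"
    proof (intro bexI conjI)
      let ?H = "((off_hyperplane X K)\<^sup>* \<inter> V \<times> V) `` {z}"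
      show "?H \<in> halfspaces X K"
        unfolding halfspaces_def off_hyperplane_def[symmetric] by (rule quotientI[OF JV[OF z]])
      show "x\<^sub>0 \<notin> ?H"
        using sides_off[OF F(1), of z x\<^sub>0] F(2) by auto
      show "\<Union>J \<subseteq> ?H"
        using halfspace_of_hyperplane[OF J K ne ntr z] JV z by blast
    qed
    ultimately show False
      using peripheral[OF K] by (simp add: separates_def)
  qed
  then have "z \<in> Y"
    using gdist_gallery[OF x\<^sub>0 JV[OF z]] by (simp add: Y_iff_gallery)
  moreover obtain y where "{z, y} \<in> J"
    by (rule \<J>_edge_at[OF J z])
  ultimately show thesis
    using that by blast
qed

lemma gallery_const:
  assumes "\<And>a b. {a, b} \<in> E \<Longrightarrow> \<forall>J\<in>\<J>. {a, b} \<notin> J \<Longrightarrow> F b = F a"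
  shows "gallery n x y \<Longrightarrow> n = 0 \<Longrightarrow> F y = F x"
proof (induction rule: gallery.induct)
  case (stay n x y z)
  then show ?case using assms[OF stay.hyps(2,3)] by simp
qed simp_all

subsection \<open>Holonomy\<close>

text \<open>Developing map for rules that act only at crossings of \<open>\<J>\<close>. The rule
  \<open>f a J\<close> may depend on the vertex \<open>a\<close>, so squares impose two conditions:
  \<open>one\<close> when a single parallel class of edges counts, \<open>two\<close> when both
  do.\<close>

lemma crossing_map:
  fixes f :: "'v \<Rightarrow> 'v set set \<Rightarrow> 's \<Rightarrow> 's" and S :: "'s set"
  assumes s: "s \<in> S"
    and closed: "\<And>J a b t. \<lbrakk>J \<in> \<J>; {a, b} \<in> J; t \<in> S\<rbrakk> \<Longrightarrow> f a J t \<in> S"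
    and inverse: "\<And>J a b t. \<lbrakk>J \<in> \<J>; {a, b} \<in> J; t \<in> S\<rbrakk> \<Longrightarrow> f b J (f a J t) = t"
    and one: "\<And>J a b d t. \<lbrakk>J \<in> \<J>; {a, b} \<in> J; {a, d} \<in> E; \<forall>K\<in>\<J>. {a, d} \<notin> K; t \<in> S\<rbrakk> \<Longrightarrow> f d J t = f a J t"
    and two: "\<And>J K a b c d t. \<lbrakk>J \<in> \<J>; K \<in> \<J>; {a, b} \<in> J; {b, c} \<in> K; {a, d} \<in> K; {d, c} \<in> J;
      {a, b, c, d} \<in> squares X; t \<in> S\<rbrakk> \<Longrightarrow> f b K (f a J t) = f d J (f a K t)"
  obtains F where "F x\<^sub>0 = s" "\<And>x. F x \<in> S"
    "\<And>J a b. J \<in> \<J> \<Longrightarrow> {a, b} \<in> J \<Longrightarrow> F b = f a J (F a)"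
    "\<And>a b. {a, b} \<in> E \<Longrightarrow> \<forall>J\<in>\<J>. {a, b} \<notin> J \<Longrightarrow> F b = F a"
proof -
  \<comment> \<open>The description is proper because distinct hyperplanes share no edge; an edge
    dual to no member of \<open>\<J>\<close> leaves the state alone.\<close>
  define T where "T a b t = (if \<exists>J\<in>\<J>. {a, b} \<in> J then f a (THE J. J \<in> \<J> \<and> {a, b} \<in> J) t else t)" for a b t
  have cross: "T a b t = f a J t" if "J \<in> \<J>" "{a, b} \<in> J" for a b t J
  proof -
    have "(THE J. J \<in> \<J> \<and> {a, b} \<in> J) = J"
      using that \<J>_unique by (intro the_equality) auto
    then show ?thesis
      using that unfolding T_def by auto
  qed
  have stay: "T a b t = t" if "\<forall>J\<in>\<J>. {a, b} \<notin> J" for a b t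
    using that unfolding T_def by auto
  have "flat_transport X T S"
  proof
    show "T a b t \<in> S" if "t \<in> S" for t a b
      using that by (cases "\<forall>J\<in>\<J>. {a, b} \<notin> J") (auto simp: stay cross intro: closed)
    show "T b a (T a b t) = t" if "t \<in> S" "{a, b} \<in> E" for t a b
    proof (cases "\<forall>J\<in>\<J>. {a, b} \<notin> J")
      case True
      then show ?thesis by (simp add: stay insert_commute)
    next
      case False
      then obtain J where J: "J \<in> \<J>" "{a, b} \<in> J" by blast
      then have "{b, a} \<in> J" by (simp add: insert_commute)
      with J show ?thesis using inverse that(1) by (simp add: cross[OF J(1)])
    qed
    fix t a b c d
    assume t: "t \<in> S" and sq: "{a, b, c, d} \<in> squares X"
      and e: "{a, b} \<in> E" "{b, c} \<in> E" "{a, d} \<in> E" "{d, c} \<in> E"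
    have "({a, b}, {d, c}) \<in> opposite X" "({d, c}, {a, b}) \<in> opposite X"
      "({b, c}, {a, d}) \<in> opposite X" "({a, d}, {b, c}) \<in> opposite X"
      using square_opposite[of a b c d X] square_opposite[of d c b a X]
        square_opposite[of b c d a X] square_opposite[of a d c b X] sq e
      by (simp_all add: insert_commute)
    then have opp: "{a, b} \<in> J \<longleftrightarrow> {d, c} \<in> J" "{b, c} \<in> J \<longleftrightarrow> {a, d} \<in> J" if "J \<in> \<J>" for J
      using hyperplane_opposite[OF \<J>_hyperplane[OF that]] by blast+
    \<comment> \<open>The two edges at \<open>a\<close> suffice for the case split, as opposite
      edges are dual to the same hyperplanes.\<close>
    consider "\<forall>J\<in>\<J>. {a, b} \<notin> J" "\<forall>J\<in>\<J>. {a, d} \<notin> J" | J where "J \<in> \<J>" "{a, b} \<in> J" "\<forall>J\<in>\<J>. {a, d} \<notin> J"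
      | K where "K \<in> \<J>" "\<forall>J\<in>\<J>. {a, b} \<notin> J" "{a, d} \<in> K"
      | J K where "J \<in> \<J>" "K \<in> \<J>" "{a, b} \<in> J" "{a, d} \<in> K"
      by blast
    then show "T b c (T a b t) = T d c (T a d t)"
    proof cases
      case 1
      then show ?thesis using opp by (simp add: stay)
    next
      case (2 J)
      then show ?thesis using opp one[of J a b d t] e t by (simp add: stay cross[of J])
    next
      case (3 K)
      then show ?thesis using opp one[of K a d b t] e t by (simp add: stay cross[of K])
    next
      case (4 J K)
      then show ?thesis using opp two[of J K a b c d t] sq t by (simp add: cross[of J] cross[of K])
    qed
  qed
  then obtain F where "F x\<^sub>0 = s" "\<And>x. F x \<in> S" and step: "\<And>a b. {a, b} \<in> E \<Longrightarrow> F b = T a b (F a)"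
    by (rule flat_transport.developing_map[OF _ simply_connected x\<^sub>0 s]) (rule that)
  then show thesis
  proof (intro that)
    show "F b = f a J (F a)" if "J \<in> \<J>" "{a, b} \<in> J" for J a b
      using step[OF \<J>_edge[OF that]] cross[OF that] by simp
    show "F b = F a" if "{a, b} \<in> E" "\<forall>J\<in>\<J>. {a, b} \<notin> J" for a b
      using step[OF that(1)] stay[OF that(2)] by simp
  qed
qed

lemma square_translate_both:
  assumes "J \<in> \<J>" "K \<in> \<J>" "{a, b} \<in> J" "{b, c} \<in> K" "{a, d} \<in> K" "{d, c} \<in> J" "{a, b, c, d} \<in> squares X"
  shows "translate \<phi> (r J) K = K" "translate \<phi> (r K) J = J"
  using square_translate(3)[of J a b K c d] square_translate(3)[of K a d J c b] assms \<J>_edge[of J] \<J>_edge[of K]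
  by (simp_all add: insert_commute)

text \<open>The value \<open>h x\<close> is meant to be the element of \<open>R\<close> whose
  translate of \<open>Y\<close> contains \<open>x\<close>, as \<open>holonomy_fold\<close>
  confirms.\<close>

definition is_holonomy :: "('v \<Rightarrow> 'g) \<Rightarrow> bool" where
  "is_holonomy h \<longleftrightarrow> h x\<^sub>0 = \<one> \<and> (\<forall>x. h x \<in> R) \<and>
     (\<forall>J\<in>\<J>. \<forall>a b. {a, b} \<in> J \<longrightarrow> h b = r J \<otimes> h a) \<and>
     (\<forall>a b. {a, b} \<in> E \<longrightarrow> (\<forall>J\<in>\<J>. {a, b} \<notin> J) \<longrightarrow> h b = h a)"

lemma holonomy_exists: "\<exists>h. is_holonomy h"
proof (rule crossing_map[of \<one> R "\<lambda>a J g. r J \<otimes> g"])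
  show "\<one> \<in> R"
    by (rule generate.one)
  fix J t and a b :: 'v
  assume J: "J \<in> \<J>" and t: "t \<in> R"
  then have t': "t \<in> carrier G"
    using R_closed by blast
  show "r J \<otimes> t \<in> R"
    using J t by (intro generate.eng r_in_R)
  show "r J \<otimes> (r J \<otimes> t) = t"
    using J t' r_involution[OF J] by (simp flip: m_assoc)
  \<comment> \<open>The reflection \<open>r J\<close> preserves \<open>K\<close>, so by the
    conjugation rule the two reflections commute.\<close>
  show "r K \<otimes> (r J \<otimes> t) = r J \<otimes> (r K \<otimes> t)"
    if "K \<in> \<J>" "{a, b} \<in> J" "{b, c} \<in> K" "{a, d} \<in> K" "{d, c} \<in> J" "{a, b, c, d} \<in> squares X" for K a b c d
    using r_translate[of "r J" K] square_translate_both[OF J that(1-6)] J that(1) t' by (simp flip: m_assoc)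
next
  fix h
  assume "h x\<^sub>0 = \<one>" "\<And>x. h x \<in> R" "\<And>J a b. J \<in> \<J> \<Longrightarrow> {a, b} \<in> J \<Longrightarrow> h b = r J \<otimes> h a"
    "\<And>a b. {a, b} \<in> E \<Longrightarrow> \<forall>J\<in>\<J>. {a, b} \<notin> J \<Longrightarrow> h b = h a"
  then have "is_holonomy h"
    unfolding is_holonomy_def by blast
  then show ?thesis
    by (rule exI[of _ h])
qed simp

definition holonomy :: "'v \<Rightarrow> 'g" where
  "holonomy = (SOME h. is_holonomy h)"

lemma is_holonomy_holonomy: "is_holonomy holonomy"
  unfolding holonomy_def by (rule someI_ex[OF holonomy_exists])

lemma holonomy_base [simp]: "holonomy x\<^sub>0 = \<one>"
  using is_holonomy_holonomy by (simp only: is_holonomy_def)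

lemma holonomy_in_R: "holonomy x \<in> R"
  using is_holonomy_holonomy by (simp only: is_holonomy_def)

lemma holonomy_cross: "J \<in> \<J> \<Longrightarrow> {a, b} \<in> J \<Longrightarrow> holonomy b = r J \<otimes> holonomy a"
  using is_holonomy_holonomy unfolding is_holonomy_def by metis

lemma holonomy_stay: "{a, b} \<in> E \<Longrightarrow> \<forall>J\<in>\<J>. {a, b} \<notin> J \<Longrightarrow> holonomy b = holonomy a"
  using is_holonomy_holonomy unfolding is_holonomy_def by metis

lemma holonomy_closed [simp]: "holonomy x \<in> carrier G"
  using holonomy_in_R R_closed by blast

lemma V_induct [consumes 1, case_names base cross stay]:
  assumes "x \<in> V" "P x\<^sub>0"
    and "\<And>J a b. J \<in> \<J> \<Longrightarrow> {a, b} \<in> J \<Longrightarrow> P a \<Longrightarrow> P b"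
    and "\<And>a b. {a, b} \<in> E \<Longrightarrow> \<forall>J\<in>\<J>. {a, b} \<notin> J \<Longrightarrow> P a \<Longrightarrow> P b"
  shows "P x"
  using edge_connected x\<^sub>0 assms(1)
proof (induction rule: edge_connected_induct)
  case (step a b)
  then show ?case
    using assms(3,4) by (cases "\<forall>J\<in>\<J>. {a, b} \<notin> J") blast+
qed (rule assms(2))

text \<open>Crossing \<open>J\<close> multiplies both sides on the left by the reflection in the
  translated hyperplane, because \<open>r_translate\<close> moves it past \<open>g\<close>. The last
  factor corrects the value at \<open>x\<^sub>0\<close>.\<close>

lemma holonomy_translate:
  assumes g: "g \<in> carrier G"
  shows "x \<in> V \<Longrightarrow> holonomy (\<phi> g x) = g \<otimes> holonomy x \<otimes> inv g \<otimes> holonomy (\<phi> g x\<^sub>0)"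
proof (induction rule: V_induct)
  case (cross J a b)
  let ?h = "holonomy (\<phi> g x\<^sub>0)"
  have "holonomy (\<phi> g b) = r (translate \<phi> g J) \<otimes> (g \<otimes> holonomy a \<otimes> inv g \<otimes> ?h)"
    using holonomy_cross[OF translate_closed[OF g cross(1)] translate_edge[OF cross(2)]] cross(3) by simp
  also have "\<dots> = (r (translate \<phi> g J) \<otimes> g) \<otimes> holonomy a \<otimes> inv g \<otimes> ?h"
    using g translate_closed[OF g cross(1)] by (simp add: m_assoc)
  also have "\<dots> = g \<otimes> holonomy b \<otimes> inv g \<otimes> ?h"
    unfolding r_translate[OF g cross(1)] holonomy_cross[OF cross(1,2)]
    using g cross(1) by (simp add: m_assoc)
  finally show ?case .
next
  case (stay a b)
  then show ?case
    using holonomy_stay[OF action_edge[OF g] translate_stay[OF g]] holonomy_stay by simp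
qed (use g in simp)

text \<open>For a generator \<open>r J\<close>, evaluate \<open>holonomy_translate\<close> at an
  endpoint \<open>a\<close> of a dual edge \<open>{a, b}\<close>: the image is \<open>b\<close>,
  whose value is \<open>r J \<otimes> holonomy a\<close> already. Cancelling shows that the
  correction factor is \<open>r J\<close>, and products follow by induction.\<close>

lemma holonomy_equivariant:
  assumes "g \<in> R"
  shows "\<forall>x\<in>V. holonomy (\<phi> g x) = g \<otimes> holonomy x"
  using assms
proof (induction rule: R_induct)
  case (mult J g)
  obtain a b where ab: "{a, b} \<in> J"
    by (rule \<J>_edge_exists[OF mult(1)])
  note V = \<J>_vertices[OF mult(1) ab]
  have "r J \<otimes> holonomy a = r J \<otimes> holonomy a \<otimes> (inv (r J) \<otimes> holonomy (\<phi> (r J) x\<^sub>0))"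
    using holonomy_translate[OF r_closed[OF mult(1)] V(1)] r_swap[OF mult(1) ab]
      holonomy_cross[OF mult(1) ab] x\<^sub>0 mult(1) by (simp add: m_assoc)
  then have "inv (r J) \<otimes> holonomy (\<phi> (r J) x\<^sub>0) = \<one>"
    using mult(1) by (metis holonomy_closed inv_closed l_cancel_one' m_closed r_closed)
  then have "holonomy (\<phi> (r J) x) = r J \<otimes> holonomy x" if "x \<in> V" for x
    using holonomy_translate[OF r_closed[OF mult(1)] that] mult(1) by (simp add: m_assoc)
  then show ?case
    using mult R_closed by (auto simp: action_mult m_assoc subset_iff)
qed simp

lemma holonomy_Y: "y \<in> Y \<Longrightarrow> holonomy y = \<one>"
  unfolding Y_iff_gallery using gallery_const[of holonomy 0 x\<^sub>0 y] holonomy_stay by simp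

text \<open>Along a crossing the folded point does not move, as the new factor \<open>r J\<close>
  sends \<open>b\<close> back to \<open>a\<close>. Along a free edge it moves by a translated free
  edge and so stays in \<open>Y\<close>.\<close>

lemma holonomy_fold: "x \<in> V \<Longrightarrow> \<phi> (inv (holonomy x)) x \<in> Y"
proof (induction rule: V_induct)
  case base
  show ?case using x\<^sub>0_in_Y x\<^sub>0 by simp
next
  case (cross J a b)
  then show ?case
    using \<J>_vertices[OF cross(1,2)]
    by (simp add: holonomy_cross[OF cross(1,2)] inv_mult_group inv_r action_mult r_swap[OF cross(1,2)])
next
  case (stay a b)
  have "gallery 0 x\<^sub>0 (\<phi> (inv (holonomy a)) b)"
    using stay(3) gallery.stay[OF _ action_edge[OF _ stay(1)] translate_stay[OF _ stay(1,2)]]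
    by (simp add: Y_iff_gallery)
  then show ?case
    by (simp add: Y_iff_gallery holonomy_stay[OF stay(1,2)])
qed

section \<open>The fundamental domain and the semidirect product\<close>

theorem fundamental_domain_Y: "fundamental_domain (G\<lparr>carrier := R\<rparr>) X \<phi> Y"
  unfolding fundamental_domain_def
proof (intro conjI ballI Y_vertices)
  fix Z
  assume "Z \<in> orbits (G\<lparr>carrier := R\<rparr>) V \<phi>"
  then obtain x where x: "x \<in> V" and Z: "Z = {\<phi> g x |g. g \<in> R}"
    by (auto simp: orbits_def orbit_def)
  have "inv (holonomy x) \<in> R"
    using subgroup.m_inv_closed[OF R_subgroup holonomy_in_R] .
  then have "\<phi> (inv (holonomy x)) x \<in> Z \<inter> Y"
    using holonomy_fold[OF x] Z by blast
  moreover have "y = \<phi> (inv (holonomy x)) x" if y: "y \<in> Z \<inter> Y" for y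
  proof -
    obtain g where g: "g \<in> R" "y = \<phi> g x"
      using y Z by blast
    \<comment> \<open>The map \<open>holonomy\<close> is trivial on \<open>Y\<close> and
      equivariant, so the element moving \<open>x\<close> into \<open>Y\<close> is
      determined.\<close>
    then have "g \<otimes> holonomy x = \<one>"
      using holonomy_equivariant[OF g(1)] x holonomy_Y[of y] y by simp
    then have "inv (holonomy x) = g"
      using g R_closed by (intro inv_equality) auto
    then show ?thesis
      using g by simp
  qed
  ultimately show "\<exists>!y. y \<in> Z \<inter> Y"
    by blast
qed

text \<open>By \<open>Y_iff_gallery\<close>, \<open>Y\<close> is a class of
  \<open>gallery 0\<close>, and the action permutes these classes; one common point gives
  equality.\<close>

lemma translate_Y:
  assumes g: "g \<in> carrier G" and "\<phi> g x\<^sub>0 \<in> Y"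
  shows "\<phi> g ` Y = Y"
proof -
  have g0: "gallery 0 x\<^sub>0 (\<phi> g x\<^sub>0)" "gallery 0 (\<phi> g x\<^sub>0) x\<^sub>0"
    using assms(2) Y_iff_gallery gallery_sym by blast+
  have "\<phi> g y \<in> Y" if "y \<in> Y" for y
    using gallery_trans[OF gallery_translate[OF g] g0(1), of 0 y] that by (simp add: Y_iff_gallery)
  moreover have "\<phi> (inv g) y \<in> Y" if "y \<in> Y" for y
    using gallery_translate[OF inv_closed[OF g] gallery_trans[OF _ g0(2), of 0 y]] that g x\<^sub>0
    by (simp add: Y_iff_gallery)
  moreover have "\<phi> g (\<phi> (inv g) y) = y" if "y \<in> Y" for y
    using that Y_vertices g by (simp add: subset_iff)
  ultimately show ?thesis
    by (metis image_eqI image_subsetI subsetI subset_antisym)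
qed

theorem semidirect_product:
  "internal_semidirect_product G R (stabilizer G (\<lambda>g. image (\<phi> g)) Y)"
proof -
  let ?S = "stabilizer G (\<lambda>g. image (\<phi> g)) Y"
  have S_iff: "g \<in> ?S \<longleftrightarrow> g \<in> carrier G \<and> \<phi> g x\<^sub>0 \<in> Y" for g
    using translate_Y x\<^sub>0_in_Y unfolding stabilizer_def by blast
  have image: "\<phi> (g \<otimes> h) ` Y = \<phi> g ` \<phi> h ` Y" if "g \<in> carrier G" "h \<in> carrier G" for g h
    using that Y_vertices by (force simp: image_image action_mult subset_iff intro!: image_cong)
  have "subgroup ?S G"
  proof
    show "?S \<subseteq> carrier G"
      by (auto simp: stabilizer_def)
    show "\<one> \<in> ?S"
      unfolding S_iff using x\<^sub>0 x\<^sub>0_in_Y by simp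
    show "g \<otimes> h \<in> ?S" if "g \<in> ?S" "h \<in> ?S" for g h
      using that image by (simp add: stabilizer_def)
    show "inv g \<in> ?S" if g: "g \<in> ?S" for g
    proof -
      have "g \<in> carrier G" and Y: "\<phi> g ` Y = Y"
        using g by (simp_all add: stabilizer_def)
      then have "\<phi> (inv g) ` \<phi> g ` Y = \<phi> \<one> ` Y"
        using image[of "inv g" g] by simp
      also have "\<dots> = Y"
        using action_one Y_vertices by (simp add: subset_iff cong: image_cong_simp)
      finally have "\<phi> (inv g) ` Y = Y"
        unfolding Y .
      then show ?thesis
        using g by (simp add: stabilizer_def)
    qed
  qed
  moreover have "R \<inter> ?S = {\<one>}"
  proof -
    \<comment> \<open>The holonomy of \<open>\<phi> g x\<^sub>0\<close> equals \<open>g\<close> by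
      equivariance and is trivial because this vertex lies in \<open>Y\<close>.\<close>
    have "g = \<one>" if "g \<in> R" "g \<in> ?S" for g
      using that holonomy_equivariant[of g] holonomy_Y[of "\<phi> g x\<^sub>0"] x\<^sub>0 R_closed
      by (auto simp: S_iff)
    moreover have "\<one> \<in> R" "\<one> \<in> ?S"
      using generate.one x\<^sub>0 x\<^sub>0_in_Y by (auto simp: S_iff)
    ultimately show ?thesis
      by blast
  qed
  moreover have "R <#> ?S = carrier G"
  proof
    show "R <#> ?S \<subseteq> carrier G"
      using R_closed by (auto simp: set_mult_def stabilizer_def)
    show "carrier G \<subseteq> R <#> ?S"
    proof
      fix g
      assume g: "g \<in> carrier G"
      \<comment> \<open>The component of \<open>g\<close> in \<open>R\<close>: removing it on the
        left folds the image of \<open>x\<^sub>0\<close> back into \<open>Y\<close>.\<close>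
      let ?h = "holonomy (\<phi> g x\<^sub>0)"
      have "inv ?h \<otimes> g \<in> ?S"
        using g x\<^sub>0 holonomy_fold[of "\<phi> g x\<^sub>0"] by (simp add: S_iff action_mult)
      moreover have "g = ?h \<otimes> (inv ?h \<otimes> g)"
        using g by (simp flip: m_assoc)
      ultimately show "g \<in> R <#> ?S"
        using holonomy_in_R unfolding set_mult_def by blast
    qed
  qed
  ultimately show ?thesis
    unfolding internal_semidirect_product_def using R_normal by blast
qed

subsection \<open>The Coxeter group\<close>

abbreviation "\<Delta> \<equiv> crossing_graph X \<J>\<^sub>0"

lemma \<J>\<^sub>0_subset: "\<J>\<^sub>0 \<subseteq> \<J>"
  by (auto simp: maximal_peripheral_def)

lemma fst_\<Delta> [simp]: "fst \<Delta> = \<J>\<^sub>0"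
  by (simp add: crossing_graph_def)

text \<open>The type of a crossing: \<open>J\<close> is carried back by the holonomy of
  \<open>a\<close> to a hyperplane adjacent to \<open>Y\<close>.\<close>

abbreviation label :: "'v \<Rightarrow> 'v set set \<Rightarrow> 'v set set" where
  "label a J \<equiv> translate \<phi> (inv (holonomy a)) J"

lemma label_peripheral:
  assumes "J \<in> \<J>" "{a, b} \<in> J"
  shows "label a J \<in> \<J>\<^sub>0"
  by (rule panel_peripheral[OF translate_closed translate_edge[OF assms(2)] holonomy_fold])
    (use assms \<J>_vertices in auto)

lemma label_cross:
  assumes "J \<in> \<J>" "{a, b} \<in> J" "K \<in> \<J>"
  shows "label b K = label a (translate \<phi> (r J) K)"
  using assms by (simp add: holonomy_cross[OF assms(1,2)] inv_mult_group inv_r translate_mult)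

lemma coxeter_map:
  obtains H where "H x\<^sub>0 = \<one>\<^bsub>racg \<Delta>\<^esub>" "\<And>x. H x \<in> carrier (racg \<Delta>)"
    "\<And>J a b. J \<in> \<J> \<Longrightarrow> {a, b} \<in> J \<Longrightarrow> H b = H a \<otimes>\<^bsub>racg \<Delta>\<^esub> racg_generator \<Delta> (label a J)"
    "\<And>a b. {a, b} \<in> E \<Longrightarrow> \<forall>J\<in>\<J>. {a, b} \<notin> J \<Longrightarrow> H b = H a"
proof (rule crossing_map[of "\<one>\<^bsub>racg \<Delta>\<^esub>" "carrier (racg \<Delta>)" "\<lambda>a J A. A \<otimes>\<^bsub>racg \<Delta>\<^esub> racg_generator \<Delta> (label a J)"])
  show "\<one>\<^bsub>racg \<Delta>\<^esub> \<in> carrier (racg \<Delta>)"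
    by (rule racg_one_closed)
  fix J a b A
  assume J: "J \<in> \<J>" "{a, b} \<in> J" and A: "A \<in> carrier (racg \<Delta>)"
  show "A \<otimes>\<^bsub>racg \<Delta>\<^esub> racg_generator \<Delta> (label a J) \<in> carrier (racg \<Delta>)"
    using A label_peripheral[OF J] by (intro racg_generator_closed) simp_all
  \<comment> \<open>A reflection preserves its own hyperplane, so a crossing has the same label in
    both directions and going back cancels the generator.\<close>
  have "translate \<phi> (r J) J = J"
    by (rule translate_eqI[of _ _ _ a b]) (use J in \<open>simp_all add: r_swap[OF J] insert_commute\<close>)
  then have "label b J = label a J"
    using label_cross[OF J J(1)] by simp
  then show "A \<otimes>\<^bsub>racg \<Delta>\<^esub> racg_generator \<Delta> (label a J) \<otimes>\<^bsub>racg \<Delta>\<^esub> racg_generator \<Delta> (label b J) = A"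
    using A label_peripheral[OF J] by (simp add: racg_generator_square)
  show "A \<otimes>\<^bsub>racg \<Delta>\<^esub> racg_generator \<Delta> (label d J) = A \<otimes>\<^bsub>racg \<Delta>\<^esub> racg_generator \<Delta> (label a J)"
    if "{a, d} \<in> E" "\<forall>K\<in>\<J>. {a, d} \<notin> K" for d
    using holonomy_stay[OF that] by simp
  show "A \<otimes>\<^bsub>racg \<Delta>\<^esub> racg_generator \<Delta> (label a J) \<otimes>\<^bsub>racg \<Delta>\<^esub> racg_generator \<Delta> (label b K) =
      A \<otimes>\<^bsub>racg \<Delta>\<^esub> racg_generator \<Delta> (label a K) \<otimes>\<^bsub>racg \<Delta>\<^esub> racg_generator \<Delta> (label d J)"
    if K: "K \<in> \<J>" and e: "{b, c} \<in> K" "{a, d} \<in> K" "{d, c} \<in> J" and sq: "{a, b, c, d} \<in> squares X" for K c d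
  proof -
    have "label b K = label a K" "label d J = label a J"
      using label_cross[OF J K] label_cross[OF K e(2) J(1)] square_translate_both[OF J(1) K J(2) e sq] by simp_all
    \<comment> \<open>Transversality survives the translation to \<open>Y\<close>, so each square
      yields a commutation relator of the Coxeter group.\<close>
    moreover have "{label a J, label a K} \<in> snd \<Delta>"
      using transverse_square[OF J e(1) sq inv_closed[OF holonomy_closed] K]
        label_peripheral[OF J] label_peripheral[OF K e(2)]
      unfolding crossing_graph_def by auto
    ultimately show ?thesis
      using racg_generator_commute[OF A] label_peripheral[OF J] label_peripheral[OF K e(2)] by simp
  qed
qed (rule that)

text \<open>Relators hold since transverse reflections commute. The inverse of \<open>\<psi>\<close>
  is \<open>g\<close> mapped to \<open>H (\<phi> g x\<^sub>0)\<close>: one composite is the identity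
  because \<open>\<psi>\<close> turns \<open>H\<close> into \<open>holonomy\<close>, the other by
  induction on right multiplication by generators.\<close>

theorem coxeter_presentation:
  "\<exists>\<psi>\<in>iso (racg \<Delta>) (G\<lparr>carrier := R\<rparr>). \<forall>J\<in>\<J>\<^sub>0. \<psi> (racg_generator \<Delta> J) = r J"
proof -
  \<comment> \<open>The value one off \<open>\<J>\<^sub>0\<close> is a default making
    \<open>f\<close> total into the group, as \<open>presented_group_lift\<close> requires.\<close>
  define f where "f J = (if J \<in> \<J>\<^sub>0 then r J else \<one>)" for J
  have f: "f J \<in> carrier G" for J
    using \<J>\<^sub>0_subset by (auto simp: f_def)
  have relators: "word_eval G f w = \<one>" if "w \<in> racg_relators \<Delta>" for w
    using that unfolding racg_relators_def
  proof (elim UnE)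
    assume "w \<in> {[(u, True), (u, True)] |u. u \<in> fst \<Delta>}"
    then show ?thesis
      using \<J>\<^sub>0_subset r_involution by (auto simp: f_def)
  next
    assume "w \<in> {[(u, True), (v, True), (u, False), (v, False)] |u v. {u, v} \<in> snd \<Delta>}"
    then obtain u v where w: "w = [(u, True), (v, True), (u, False), (v, False)]" and uv: "{u, v} \<in> snd \<Delta>"
      by blast
    from uv obtain J K where JK: "{u, v} = {J, K}" "J \<in> \<J>\<^sub>0" "K \<in> \<J>\<^sub>0" "transverse X J K"
      unfolding crossing_graph_def by auto
    have J: "J \<in> \<J>" "K \<in> \<J>"
      using JK \<J>\<^sub>0_subset by auto
    have "f J \<otimes> f K = f K \<otimes> f J"
      using r_translate[OF r_closed[OF J(1)] J(2)] transverse_translate[OF J JK(4)] JK by (simp add: f_def)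
    then have "f u \<otimes> f v = f v \<otimes> f u"
      using JK(1) by (auto simp: doubleton_eq_iff)
    then have "(f u \<otimes> f v) \<otimes> inv (f v \<otimes> f u) = \<one>"
      using f by simp
    then have "f u \<otimes> (f v \<otimes> (inv (f u) \<otimes> inv (f v))) = \<one>"
      using f by (simp add: inv_mult_group m_assoc)
    then show ?thesis
      using f by (simp add: w)
  qed
  obtain \<psi> where hom: "\<psi> \<in> hom (racg \<Delta>) G"
    and eval: "\<And>w. w \<in> lists (\<J>\<^sub>0 \<times> UNIV) \<Longrightarrow> \<psi> (word_class \<J>\<^sub>0 (racg_relators \<Delta>) w) = word_eval G f w"
    using presented_group_lift[where S = \<J>\<^sub>0 and R = "racg_relators \<Delta>", OF f relators]
    unfolding racg_def fst_\<Delta> by metis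
  have gen: "\<psi> (racg_generator \<Delta> J) = r J" if "J \<in> \<J>\<^sub>0" for J
    using eval[of "[(J, True)]"] that \<J>\<^sub>0_subset
    by (auto simp: racg_generator_def presented_generator_def word_class_def f_def)
  have \<psi>_one: "\<psi> \<one>\<^bsub>racg \<Delta>\<^esub> = \<one>"
    using eval[of "[]"] by (simp add: racg_def presented_group_def word_class_def)
  have \<psi>_mult: "\<psi> (A \<otimes>\<^bsub>racg \<Delta>\<^esub> racg_generator \<Delta> J) = \<psi> A \<otimes> r J" if "A \<in> carrier (racg \<Delta>)" "J \<in> \<J>\<^sub>0" for A J
    using hom_mult[OF hom that(1) racg_generator_in_carrier] gen that by simp
  have R: "\<psi> A \<in> R" if "A \<in> carrier (racg \<Delta>)" for A
    using that
  proof (induction rule: racg_induct)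
    case one
    show ?case unfolding \<psi>_one by (rule generate.one)
  next
    case (mult A J)
    then show ?case
      using \<psi>_mult r_in_R \<J>\<^sub>0_subset by (auto intro!: generate.eng)
  qed
  obtain H where H: "H x\<^sub>0 = \<one>\<^bsub>racg \<Delta>\<^esub>" "\<And>x. H x \<in> carrier (racg \<Delta>)"
    and H_cross: "\<And>J a b. J \<in> \<J> \<Longrightarrow> {a, b} \<in> J \<Longrightarrow> H b = H a \<otimes>\<^bsub>racg \<Delta>\<^esub> racg_generator \<Delta> (label a J)"
    and H_stay: "\<And>a b. {a, b} \<in> E \<Longrightarrow> \<forall>J\<in>\<J>. {a, b} \<notin> J \<Longrightarrow> H b = H a"
    by (rule coxeter_map) (rule that)
  have \<psi>H: "\<psi> (H x) = holonomy x" if "x \<in> V" for x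
    using that
  proof (induction rule: V_induct)
    case base
    show ?case by (simp add: H \<psi>_one)
  next
    case (cross J a b)
    have L: "label a J \<in> \<J>\<^sub>0" "label a J \<in> \<J>"
      using label_peripheral[OF cross(1,2)] \<J>\<^sub>0_subset by auto
    have "\<psi> (H b) = holonomy a \<otimes> r (label a J)"
      using H_cross[OF cross(1,2)] \<psi>_mult[OF H(2) L(1)] cross(3) by simp
    \<comment> \<open>Conjugation by the holonomy turns the label back into \<open>J\<close>; right
      multiplication in the Coxeter group becomes the left multiplication of
      \<open>holonomy_cross\<close>.\<close>
    also have "\<dots> = r J \<otimes> holonomy a"
      using r_translate[OF holonomy_closed[of a] L(2)] translate_inv(2)[OF holonomy_closed[of a] cross(1)] by simp
    finally show ?case
      using holonomy_cross[OF cross(1,2)] by simp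
  next
    case (stay a b)
    then show ?case
      using H_stay holonomy_stay by simp
  qed
  have H\<psi>: "H (\<phi> (\<psi> A) x\<^sub>0) = A" if "A \<in> carrier (racg \<Delta>)" for A
    using that
  proof (induction rule: racg_induct)
    case one
    show ?case using H x\<^sub>0 \<psi>_one by simp
  next
    case (mult A J)
    then have J0: "J \<in> \<J>\<^sub>0" and J: "J \<in> \<J>"
      using \<J>\<^sub>0_subset by auto
    let ?g = "\<psi> A"
    have gR: "?g \<in> R"
      by (rule R[OF mult(1)])
    then have g: "?g \<in> carrier G"
      using R_closed by blast
    obtain a b where ab: "{a, b} \<in> J" and a: "a \<in> Y"
      by (rule peripheral_panel[OF J0])
    note V = \<J>_vertices[OF J ab]
    \<comment> \<open>Translates of \<open>Y\<close> are crossed for free, so the basepoint may be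
      replaced by \<open>a\<close>, which is adjacent to \<open>J\<close>.\<close>
    have H0: "H (\<phi> k a) = H (\<phi> k x\<^sub>0)" if "k \<in> carrier G" for k
      using gallery_const[of H, OF H_stay gallery_translate[OF that]] a by (simp add: Y_iff_gallery)
    have "holonomy (\<phi> ?g a) = ?g"
      using holonomy_equivariant[OF gR] V(1) holonomy_Y[OF a] g by simp
    \<comment> \<open>At \<open>\<phi> ?g a\<close> the holonomy is \<open>?g\<close>, so the
      crossing of the translate of \<open>J\<close> by \<open>?g\<close> has label exactly
      \<open>J\<close>.\<close>
    then have "H (\<phi> ?g b) = H (\<phi> ?g a) \<otimes>\<^bsub>racg \<Delta>\<^esub> racg_generator \<Delta> J"
      using H_cross[OF translate_closed[OF g J] translate_edge[OF ab]] translate_inv(1)[OF g J] by simp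
    moreover have "\<phi> (?g \<otimes> r J) a = \<phi> ?g b"
      using g J V r_swap[OF J ab] by (simp add: action_mult)
    ultimately have "H (\<phi> (?g \<otimes> r J) x\<^sub>0) = A \<otimes>\<^bsub>racg \<Delta>\<^esub> racg_generator \<Delta> J"
      using H0[OF g] H0[of "?g \<otimes> r J"] g J mult(3) by simp
    then show ?case
      using \<psi>_mult mult(1) J0 by simp
  qed
  have "bij_betw \<psi> (carrier (racg \<Delta>)) R"
  proof (rule bij_betw_byWitness[of _ "\<lambda>g. H (\<phi> g x\<^sub>0)"])
    show "\<forall>g\<in>R. \<psi> (H (\<phi> g x\<^sub>0)) = g"
      using \<psi>H holonomy_equivariant x\<^sub>0 R_closed by (auto simp: subset_iff)
  qed (use H\<psi> R H in auto)
  moreover have "\<psi> \<in> hom (racg \<Delta>) (G\<lparr>carrier := R\<rparr>)"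
    using hom R by (auto simp: hom_def)
  ultimately show ?thesis
    using gen unfolding iso_def by auto
qed

end

theorem theorem3p3:
  fixes G :: "('g, 'm) monoid_scheme" and X :: "'v set set" and \<phi> :: "'g \<Rightarrow> 'v \<Rightarrow> 'v"
    and \<J> :: "'v set set set" and r :: "'v set set \<Rightarrow> 'g" and x\<^sub>0 :: 'v
  defines "Y \<equiv> halfspace_intersection X \<J> x\<^sub>0"
    and "R \<equiv> generate G (r ` \<J>)"
    and "\<J>\<^sub>0 \<equiv> maximal_peripheral X x\<^sub>0 \<J>"
  defines "\<Delta> \<equiv> crossing_graph X \<J>\<^sub>0"
  assumes "group G" and "CAT0_cube_complex X" and "cubical_action G X \<phi>"
    and "\<forall>x\<in>vertices X. stabilizer G \<phi> x = {\<one>\<^bsub>G\<^esub>}"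
    and "\<J> \<subseteq> hyperplanes X"
    and "\<forall>g\<in>carrier G. \<forall>J\<in>\<J>. (\<lambda>e. \<phi> g ` e) ` J \<in> \<J>"
    and "\<forall>J\<in>\<J>. r J \<in> carrier G \<and> reflection X J (\<phi> (r J))"
    and "x\<^sub>0 \<in> vertices X"
  shows "internal_semidirect_product G R (stabilizer G (\<lambda>g. image (\<phi> g)) Y) \<and>
    fundamental_domain (G\<lparr>carrier := R\<rparr>) X \<phi> Y \<and>
    (\<exists>\<psi>\<in>iso (racg \<Delta>) (G\<lparr>carrier := R\<rparr>). \<forall>J\<in>\<J>\<^sub>0. \<psi> (racg_generator \<Delta> J) = r J)"
proof -
  interpret reflection_action G X \<phi> \<J> r x\<^sub>0
    using assms(5-) by (simp add: reflection_action_def reflection_action_axioms_def CAT0_cube_complex_def)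
  show ?thesis
    unfolding assms(1-4) using semidirect_product fundamental_domain_Y coxeter_presentation by blast
qed

end
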